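(* There exists a polynomial-time algorithm to solve \textsc{InvertibleSigning}: given a real symmetric matrix $M$, decide whether there exists a symmetric signing $s$ such that $M(s)$ is invertible.
   Context: For a real symmetric $n\times n$ matrix $M$, a signing is an $n\times n$ matrix $s$ with entries in $\{\pm1\}$; it is symmetric if $s$ is a symmetric matrix. The signed matrix $M(s)$ is the entry-wise product of $M$ and $s$. *)

theory Defs
  imports
    "Jordan_Normal_Form.Matrix"
    "HOL-Computational_Algebra.Polynomial"
    "HOL-Library.Discrete_Functions"
begin

section \<open>Symmetric signings\<close>

definition symmetric_mat :: "'a mat \<Rightarrow> bool" where
  "symmetric_mat A \<longleftrightarrow> square_mat A \<and> A\<^sup>T = A"

definition signing :: "nat \<Rightarrow> real mat \<Rightarrow> bool" where
  "signing n s \<longleftrightarrow> s \<in> carrier_mat n n \<and> (\<forall>i<n. \<forall>j<n. s $$ (i, j) \<in> {1, -1})"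

definition signed_mat :: "real mat \<Rightarrow> real mat \<Rightarrow> real mat" where
  "signed_mat M s = mat (dim_row M) (dim_col M) (\<lambda>(i, j). M $$ (i, j) * s $$ (i, j))"

definition invertible_signing :: "real mat \<Rightarrow> bool" where
  "invertible_signing M \<longleftrightarrow>
     (\<exists>s. signing (dim_row M) s \<and> symmetric_mat s \<and> invertible_mat (signed_mat M s))"

section \<open>Real random access machines\<close>

text \<open>
  The machine has two infinite memories, one with natural numbers (used for counting and for
  addressing) and one with real numbers. An address is either fixed in the program
  (\<open>Dir\<close>) or found in a cell of the memory of natural numbers (\<open>Ind\<close>). Programs
  contain only integer literals, and the two memories do not mix: a real number cannot be rounded
  or used as an address. Natural numbers can only be added and subtracted. With multiplication at
  unit cost, repeated squaring would produce numbers of exponential bit length in polynomially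
  many steps.
\<close>

datatype loc = Dir nat | Ind nat

datatype nat_operand = NLit nat | NCell loc

datatype real_operand = RLit int | RCell loc

datatype instr =
    NAdd loc nat_operand nat_operand
  | NSub loc nat_operand nat_operand
  | RAdd loc real_operand real_operand
  | RSub loc real_operand real_operand
  | RMul loc real_operand real_operand
  | RDiv loc real_operand real_operand

datatype test =
    NLess nat_operand nat_operand
  | NEq nat_operand nat_operand
  | RLess real_operand real_operand
  | REq real_operand real_operand

datatype prog =
    Skip
  | Do instr
  | Seq prog prog
  | Cond test prog prog
  | While test prog

record state =
  nmem :: "nat \<Rightarrow> nat"
  rmem :: "nat \<Rightarrow> real"

fun addr :: "loc \<Rightarrow> state \<Rightarrow> nat" where
  "addr (Dir i) \<sigma> = i"
| "addr (Ind i) \<sigma> = nmem \<sigma> i"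

fun nat_val :: "nat_operand \<Rightarrow> state \<Rightarrow> nat" where
  "nat_val (NLit k) \<sigma> = k"
| "nat_val (NCell l) \<sigma> = nmem \<sigma> (addr l \<sigma>)"

fun real_val :: "real_operand \<Rightarrow> state \<Rightarrow> real" where
  "real_val (RLit k) \<sigma> = real_of_int k"
| "real_val (RCell l) \<sigma> = rmem \<sigma> (addr l \<sigma>)"

definition nat_store :: "loc \<Rightarrow> nat \<Rightarrow> state \<Rightarrow> state" where
  "nat_store l v \<sigma> = \<sigma>\<lparr>nmem := (nmem \<sigma>)(addr l \<sigma> := v)\<rparr>"

definition real_store :: "loc \<Rightarrow> real \<Rightarrow> state \<Rightarrow> state" where
  "real_store l v \<sigma> = \<sigma>\<lparr>rmem := (rmem \<sigma>)(addr l \<sigma> := v)\<rparr>"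

text \<open>Subtraction of natural numbers is truncated at 0, and division by 0 yields 0.\<close>

fun exec_instr :: "instr \<Rightarrow> state \<Rightarrow> state" where
  "exec_instr (NAdd l a b) \<sigma> = nat_store l (nat_val a \<sigma> + nat_val b \<sigma>) \<sigma>"
| "exec_instr (NSub l a b) \<sigma> = nat_store l (nat_val a \<sigma> - nat_val b \<sigma>) \<sigma>"
| "exec_instr (RAdd l a b) \<sigma> = real_store l (real_val a \<sigma> + real_val b \<sigma>) \<sigma>"
| "exec_instr (RSub l a b) \<sigma> = real_store l (real_val a \<sigma> - real_val b \<sigma>) \<sigma>"
| "exec_instr (RMul l a b) \<sigma> = real_store l (real_val a \<sigma> * real_val b \<sigma>) \<sigma>"
| "exec_instr (RDiv l a b) \<sigma> = real_store l (real_val a \<sigma> / real_val b \<sigma>) \<sigma>"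

fun eval_test :: "test \<Rightarrow> state \<Rightarrow> bool" where
  "eval_test (NLess a b) \<sigma> \<longleftrightarrow> nat_val a \<sigma> < nat_val b \<sigma>"
| "eval_test (NEq a b) \<sigma> \<longleftrightarrow> nat_val a \<sigma> = nat_val b \<sigma>"
| "eval_test (RLess a b) \<sigma> \<longleftrightarrow> real_val a \<sigma> < real_val b \<sigma>"
| "eval_test (REq a b) \<sigma> \<longleftrightarrow> real_val a \<sigma> = real_val b \<sigma>"

text \<open>
  \<open>exec ic tc c \<sigma> t \<tau>\<close>: started in \<open>\<sigma>\<close>, the program \<open>c\<close> halts in
  \<open>\<tau>\<close> with total cost \<open>t\<close>, where \<open>ic\<close> and \<open>tc\<close> give the cost of a
  single instruction and of a single test in the current state.
\<close>

inductive exec ::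
  "(instr \<Rightarrow> state \<Rightarrow> nat) \<Rightarrow> (test \<Rightarrow> state \<Rightarrow> nat) \<Rightarrow> prog \<Rightarrow> state \<Rightarrow> nat \<Rightarrow> state \<Rightarrow> bool"
  for ic tc where
  Skip: "exec ic tc Skip \<sigma> 1 \<sigma>"
| Do: "exec ic tc (Do i) \<sigma> (ic i \<sigma>) (exec_instr i \<sigma>)"
| Seq: "exec ic tc c \<sigma> t \<sigma>' \<Longrightarrow> exec ic tc d \<sigma>' u \<tau> \<Longrightarrow> exec ic tc (Seq c d) \<sigma> (t + u) \<tau>"
| Cond_True: "eval_test b \<sigma> \<Longrightarrow> exec ic tc c \<sigma> t \<tau> \<Longrightarrow> exec ic tc (Cond b c d) \<sigma> (tc b \<sigma> + t) \<tau>"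
| Cond_False: "\<not> eval_test b \<sigma> \<Longrightarrow> exec ic tc d \<sigma> t \<tau> \<Longrightarrow> exec ic tc (Cond b c d) \<sigma> (tc b \<sigma> + t) \<tau>"
| While_False: "\<not> eval_test b \<sigma> \<Longrightarrow> exec ic tc (While b c) \<sigma> (tc b \<sigma>) \<sigma>"
| While_True: "eval_test b \<sigma> \<Longrightarrow> exec ic tc c \<sigma> t \<sigma>' \<Longrightarrow> exec ic tc (While b c) \<sigma>' u \<tau> \<Longrightarrow>
    exec ic tc (While b c) \<sigma> (tc b \<sigma> + t + u) \<tau>"

section \<open>Unit cost and bit cost\<close>

abbreviation exec_unit :: "prog \<Rightarrow> state \<Rightarrow> nat \<Rightarrow> state \<Rightarrow> bool" where
  "exec_unit \<equiv> exec (\<lambda>_ _. 1) (\<lambda>_ _. 1)"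

definition nat_bits :: "nat \<Rightarrow> nat" where
  "nat_bits n = Suc (floor_log n)"

text \<open>The bit length of a rational number in lowest terms; irrelevant for irrational arguments.\<close>

definition rat_bits :: "real \<Rightarrow> nat" where
  "rat_bits x = (let (a, b) = quotient_of (THE q. x = real_of_rat q)
                 in nat_bits (nat \<bar>a\<bar>) + nat_bits (nat b))"

text \<open>The logarithmic cost criterion: an access is charged with the lengths of all numbers involved,
  addresses included.\<close>

fun addr_bits :: "loc \<Rightarrow> state \<Rightarrow> nat" where
  "addr_bits (Dir i) \<sigma> = nat_bits i"
| "addr_bits (Ind i) \<sigma> = nat_bits i + nat_bits (nmem \<sigma> i)"

fun nat_operand_bits :: "nat_operand \<Rightarrow> state \<Rightarrow> nat" where
  "nat_operand_bits (NLit k) \<sigma> = nat_bits k"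
| "nat_operand_bits (NCell l) \<sigma> = addr_bits l \<sigma> + nat_bits (nat_val (NCell l) \<sigma>)"

fun real_operand_bits :: "real_operand \<Rightarrow> state \<Rightarrow> nat" where
  "real_operand_bits (RLit k) \<sigma> = rat_bits (real_of_int k)"
| "real_operand_bits (RCell l) \<sigma> = addr_bits l \<sigma> + rat_bits (real_val (RCell l) \<sigma>)"

fun instr_bits :: "instr \<Rightarrow> state \<Rightarrow> nat" where
  "instr_bits (NAdd l a b) \<sigma> = addr_bits l \<sigma> + nat_operand_bits a \<sigma> + nat_operand_bits b \<sigma>"
| "instr_bits (NSub l a b) \<sigma> = addr_bits l \<sigma> + nat_operand_bits a \<sigma> + nat_operand_bits b \<sigma>"
| "instr_bits (RAdd l a b) \<sigma> = addr_bits l \<sigma> + real_operand_bits a \<sigma> + real_operand_bits b \<sigma>"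
| "instr_bits (RSub l a b) \<sigma> = addr_bits l \<sigma> + real_operand_bits a \<sigma> + real_operand_bits b \<sigma>"
| "instr_bits (RMul l a b) \<sigma> = addr_bits l \<sigma> + real_operand_bits a \<sigma> + real_operand_bits b \<sigma>"
| "instr_bits (RDiv l a b) \<sigma> = addr_bits l \<sigma> + real_operand_bits a \<sigma> + real_operand_bits b \<sigma>"

fun test_bits :: "test \<Rightarrow> state \<Rightarrow> nat" where
  "test_bits (NLess a b) \<sigma> = nat_operand_bits a \<sigma> + nat_operand_bits b \<sigma>"
| "test_bits (NEq a b) \<sigma> = nat_operand_bits a \<sigma> + nat_operand_bits b \<sigma>"
| "test_bits (RLess a b) \<sigma> = real_operand_bits a \<sigma> + real_operand_bits b \<sigma>"
| "test_bits (REq a b) \<sigma> = real_operand_bits a \<sigma> + real_operand_bits b \<sigma>"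

abbreviation exec_bits :: "prog \<Rightarrow> state \<Rightarrow> nat \<Rightarrow> state \<Rightarrow> bool" where
  "exec_bits \<equiv> exec instr_bits test_bits"

section \<open>Polynomial-time decision of matrix problems\<close>

text \<open>An \<open>n \<times> n\<close> matrix is presented row by row in the real cells \<open>0, \<dots>, n\<^sup>2 - 1\<close>,
  with \<open>n\<close> in cell 0 of the other memory; all other cells are 0. The answer is expected in
  cell 0 of the memory of natural numbers.\<close>

definition input_state :: "real mat \<Rightarrow> state" where
  "input_state M =
     (let n = dim_row M in
      \<lparr>nmem = (\<lambda>_. 0)(0 := n),
       rmem = (\<lambda>k. if k < n * n then M $$ (k div n, k mod n) else 0)\<rparr>)"

definition answer :: "state \<Rightarrow> bool \<Rightarrow> bool" where
  "answer \<sigma> a \<longleftrightarrow> nmem \<sigma> 0 = (if a then 1 else 0)"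

definition mat_bits :: "real mat \<Rightarrow> nat" where
  "mat_bits M = (\<Sum>i<dim_row M. \<Sum>j<dim_col M. rat_bits (M $$ (i, j)))"

text \<open>
  For real input, time is the number of arithmetic operations, comparisons and memory accesses, as a
  function of the dimension. This alone would not give a polynomial-time algorithm in the sense of
  Turing machines for rational input, because iterated multiplication can produce numbers of
  exponential length; hence the second condition, on the bit cost as a function of the bit length of
  the input.
\<close>

definition poly_time_decides :: "prog \<Rightarrow> real mat set \<Rightarrow> (real mat \<Rightarrow> bool) \<Rightarrow> bool" where
  "poly_time_decides c I P \<longleftrightarrow>
     (\<exists>p :: nat poly. \<forall>M\<in>I. \<exists>t \<tau>.
        exec_unit c (input_state M) t \<tau> \<and> t \<le> poly p (dim_row M) \<and> answer \<tau> (P M)) \<and>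
     (\<exists>p :: nat poly. \<forall>M\<in>I. elements_mat M \<subseteq> \<rat> \<longrightarrow> (\<exists>t \<tau>.
        exec_bits c (input_state M) t \<tau> \<and> t \<le> poly p (mat_bits M) \<and> answer \<tau> (P M)))"

end

theory Submission
  imports Defs "Jordan_Normal_Form.Determinant"
begin

text \<open>A symmetric matrix has an invertible symmetric signing iff some permutation selects only
  nonzero entries. For the nontrivial direction, let \<open>q\<close> be such a permutation and average
  \<open>det (M(s)) \<cdot> \<Prod>\<^sub>i s(i, q i)\<close> over all symmetric signings \<open>s\<close>. The Leibniz terms that survive
  belong to the permutations that use every undirected edge with the same parity as \<open>q\<close>. They differ
  from \<open>q\<close> only in the orientation of cycles and in the way points on 2-cycles are paired; neither
  affects the sign of the term, because 2-cycles contribute squares. Hence nothing cancels and some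
  \<open>det (M(s))\<close> is nonzero.

  A perfect matching of rows and columns is found by an auction with integer prices: an unassigned
  row takes its cheapest neighbouring column, raises its price by 1 and displaces the previous
  owner. A row all of whose neighbours cost more than \<open>n\<close> yields a violation of Hall's condition.
  The program never computes with real numbers, it only compares them to 0, and an addition of
  natural numbers makes them at most one bit longer; so a polynomial number of steps has polynomial
  bit cost.\<close>

section \<open>Leibniz terms of symmetric matrices\<close>

lemma bij_betw_invariant_subset:
  assumes "finite A" "bij_betw f A A" "B \<subseteq> A" "f ` B \<subseteq> B"
  shows "bij_betw f B B"
proof -
  have "finite B" "inj_on f B"
    using assms by (auto intro: finite_subset inj_on_subset bij_betw_imp_inj_on)
  with \<open>f ` B \<subseteq> B\<close> show ?thesis
    by (simp add: bij_betw_def endo_inj_surj)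
qed

lemma bij_betw_involution:
  assumes "f ` A \<subseteq> A" "\<And>x. x \<in> A \<Longrightarrow> f (f x) = x"
  shows "bij_betw f A A"
  using assms by (intro bij_betw_byWitness[where f' = f]) auto

lemma involution_remove_pair:
  assumes "f ` A \<subseteq> A" and involution: "\<And>x. x \<in> A \<Longrightarrow> f (f x) = x" and "a \<in> A"
  shows "f ` (A - {a, f a}) \<subseteq> A - {a, f a}"
proof
  fix y assume "y \<in> f ` (A - {a, f a})"
  then obtain x where "x \<in> A" "x \<noteq> a" "x \<noteq> f a" "y = f x" by auto
  then have "y \<in> A" "f y = x"
    using assms(1) involution by auto
  then show "y \<in> A - {a, f a}"
    using \<open>x \<noteq> a\<close> \<open>x \<noteq> f a\<close> involution[OF \<open>a \<in> A\<close>] by auto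
qed

definition symmetric_on :: "'a set \<Rightarrow> ('a \<Rightarrow> 'a \<Rightarrow> 'b) \<Rightarrow> bool" where
  "symmetric_on A M \<longleftrightarrow> (\<forall>i\<in>A. \<forall>j\<in>A. M i j = M j i)"

lemma symmetric_on_subset: "symmetric_on A M \<Longrightarrow> B \<subseteq> A \<Longrightarrow> symmetric_on B M"
  by (auto simp: symmetric_on_def)

definition leibniz_term :: "('a \<Rightarrow> 'a \<Rightarrow> 'b :: comm_ring_1) \<Rightarrow> 'a set \<Rightarrow> ('a \<Rightarrow> 'a) \<Rightarrow> 'b" where
  "leibniz_term M A p = of_int (sign (restrict_id p A)) * (\<Prod>i\<in>A. M i (p i))"

lemma leibniz_term_permutes:
  assumes "p permutes A"
  shows "leibniz_term M A p = of_int (sign p) * (\<Prod>i\<in>A. M i (p i))"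
proof -
  have "restrict_id p A = p"
    using permutes_not_in[OF assms] by (auto simp: restrict_id_def)
  then show ?thesis by (simp add: leibniz_term_def)
qed

lemma leibniz_term_cong:
  assumes "\<And>i. i \<in> A \<Longrightarrow> p i = q i"
  shows "leibniz_term M A p = leibniz_term M A q"
  using assms unfolding leibniz_term_def by (auto cong: restrict_id_cong prod.cong)

lemma leibniz_term_Un:
  assumes "finite A" "finite B" "A \<inter> B = {}" "bij_betw p A A" "bij_betw p B B"
  shows "leibniz_term M (A \<union> B) p = leibniz_term M A p * leibniz_term M B p"
proof -
  have "restrict_id p A permutes A" "restrict_id p B permutes B"
    using assms permutes_restrict_id by blast+
  then have "permutation (restrict_id p A)" "permutation (restrict_id p B)"
    using assms permutes_imp_permutation by blast+
  moreover have "restrict_id p (A \<union> B) = restrict_id p A \<circ> restrict_id p B"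
    using assms(3) bij_betwE[OF assms(5)] by (auto simp: restrict_id_def fun_eq_iff)
  ultimately have "sign (restrict_id p (A \<union> B)) = sign (restrict_id p A) * sign (restrict_id p B)"
    by (simp only: sign_compose)
  then show ?thesis
    using assms by (simp add: leibniz_term_def prod.union_disjoint mult_ac)
qed

lemma leibniz_term_inverse:
  assumes "finite A" and bij: "bij_betw p A A" and inverse: "\<And>i. i \<in> A \<Longrightarrow> q (p i) = i"
    and sym: "symmetric_on A M"
  shows "leibniz_term M A q = leibniz_term M A p"
proof -
  have p_in: "p i \<in> A" if "i \<in> A" for i
    using bij that by (rule bij_betw_apply)
  have perm: "restrict_id p A permutes A"
    using bij by (rule permutes_restrict_id)
  have "restrict_id q A j = Hilbert_Choice.inv (restrict_id p A) j" for j
  proof -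
    obtain i where "j = restrict_id p A i"
      using permutes_surj[OF perm] by blast
    moreover from this have "Hilbert_Choice.inv (restrict_id p A) j = i"
      using permutes_inverses(2)[OF perm] by simp
    ultimately show ?thesis
      using inverse p_in by (cases "i \<in> A") simp_all
  qed
  then have "restrict_id q A = Hilbert_Choice.inv (restrict_id p A)" ..
  then have "sign (restrict_id q A) = sign (restrict_id p A)"
    using sign_inverse[OF permutes_imp_permutation[OF \<open>finite A\<close> perm]] by simp
  moreover have "(\<Prod>i\<in>A. M i (q i)) = (\<Prod>i\<in>A. M (p i) (q (p i)))"
    by (rule prod.reindex_bij_betw[OF bij, symmetric])
  moreover have "\<dots> = (\<Prod>i\<in>A. M i (p i))"
    using p_in sym by (intro prod.cong refl) (simp add: inverse symmetric_on_def)
  ultimately show ?thesis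
    by (simp add: leibniz_term_def)
qed

lemma leibniz_term_transpose:
  assumes "a \<noteq> b" "p a = b" "p b = a"
  shows "leibniz_term M {a, b} p = - (M a b * M b a)"
proof -
  have "restrict_id p {a, b} = transpose a b"
    using assms by (auto simp: restrict_id_def transpose_def fun_eq_iff)
  then show ?thesis
    using assms by (simp add: leibniz_term_def sign_swap_id)
qed

lemma leibniz_term_involution:
  fixes M :: "'a \<Rightarrow> 'a \<Rightarrow> 'b :: linordered_idom"
  assumes "finite A" "p ` A \<subseteq> A" "\<And>i. i \<in> A \<Longrightarrow> p i \<noteq> i \<and> p (p i) = i" "symmetric_on A M"
  shows "0 \<le> (- 1) ^ (card A div 2) * leibniz_term M A p"
  using assms
proof (induction A rule: finite_psubset_induct)
  case (psubset A)
  show ?case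
  proof (cases "A = {}")
    case True
    then show ?thesis by (simp add: leibniz_term_def restrict_id_def)
  next
    case False
    then obtain a where "a \<in> A" by blast
    define b B where "b = p a" and "B = A - {a, b}"
    have partner: "b \<in> A" "b \<noteq> a" "p b = a" "p a = b"
      using \<open>a \<in> A\<close> psubset.prems(1,2) by (auto simp: b_def)
    have split: "finite B" "{a, b} \<inter> B = {}" "A = {a, b} \<union> B" "B \<subset> A"
      using \<open>a \<in> A\<close> partner psubset.hyps by (auto simp: B_def)
    have invariant: "p ` B \<subseteq> B"
      unfolding B_def b_def using psubset.prems(1,2) \<open>a \<in> A\<close> by (intro involution_remove_pair) auto
    have "bij_betw p {a, b} {a, b}" "bij_betw p B B"
      using partner invariant psubset.prems(2) split(3) by (auto intro!: bij_betw_involution)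
    then have "leibniz_term M A p = leibniz_term M {a, b} p * leibniz_term M B p"
      unfolding split(3) using split(1,2) by (intro leibniz_term_Un) auto
    also have "leibniz_term M {a, b} p = - (M a b)\<^sup>2"
      using partner \<open>a \<in> A\<close> psubset.prems(3)
      by (simp add: leibniz_term_transpose power2_eq_square symmetric_on_def)
    finally have "(- 1) ^ (card A div 2) * leibniz_term M A p
        = (M a b)\<^sup>2 * ((- 1) ^ (card B div 2) * leibniz_term M B p)"
      using split(1,2) partner(2) by (simp add: split(3) mult_ac)
    moreover have "0 \<le> (- 1) ^ (card B div 2) * leibniz_term M B p"
      using \<open>B \<subset> A\<close> invariant psubset.prems(2) symmetric_on_subset[OF psubset.prems(3)]
      by (intro psubset.IH) auto
    ultimately show ?thesis
      using mult_nonneg_nonneg[OF zero_le_power2] by simp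
  qed
qed

definition edge_count :: "'a set \<Rightarrow> ('a \<Rightarrow> 'a) \<Rightarrow> 'a set \<Rightarrow> nat" where
  "edge_count A p e = card {i \<in> A. {i, p i} = e}"

lemma odd_edge_count_loop:
  assumes "a \<in> A"
  shows "odd (edge_count A p {a}) \<longleftrightarrow> p a = a"
proof -
  have "{i \<in> A. {i, p i} = {a}} = (if p a = a then {a} else {})"
    using assms by auto
  then show ?thesis by (simp add: edge_count_def)
qed

lemma odd_edge_count_doubleton:
  assumes "a \<in> A" "b \<in> A" "a \<noteq> b"
  shows "odd (edge_count A p {a, b}) \<longleftrightarrow> (p a = b) \<noteq> (p b = a)"
proof -
  have "{i \<in> A. {i, p i} = {a, b}} = (if p a = b then {a} else {}) \<union> (if p b = a then {b} else {})"
    using assms by (auto simp: doubleton_eq_iff)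
  then show ?thesis using assms(3) by (simp add: edge_count_def)
qed

definition two_cycle_points :: "'a set \<Rightarrow> ('a \<Rightarrow> 'a) \<Rightarrow> 'a set" where
  "two_cycle_points A p = {i \<in> A. p i \<noteq> i \<and> p (p i) = i}"

lemma two_cycle_points_invariant: "p ` A \<subseteq> A \<Longrightarrow> p ` two_cycle_points A p \<subseteq> two_cycle_points A p"
  by (auto simp: two_cycle_points_def)

text \<open>Such \<open>p\<close> and \<open>q\<close> have the same loops and the same undirected cycles of length at least 3, each
  of which they may traverse in opposite directions, while the points on 2-cycles may be paired up
  differently.\<close>

locale same_edge_parity =
  fixes A :: "'a set" and p q :: "'a \<Rightarrow> 'a"
  assumes finite: "finite A" and bij_p: "bij_betw p A A" and bij_q: "bij_betw q A A"
    and parity: "odd (edge_count A p e) \<longleftrightarrow> odd (edge_count A q e)"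
begin

lemma swap: "same_edge_parity A q p"
  using finite bij_p bij_q parity by unfold_locales auto

lemma loop_iff: "i \<in> A \<Longrightarrow> p i = i \<longleftrightarrow> q i = i"
  using parity odd_edge_count_loop by metis

lemma traversed_once_iff:
  "i \<in> A \<Longrightarrow> j \<in> A \<Longrightarrow> i \<noteq> j \<Longrightarrow> (p i = j) \<noteq> (p j = i) \<longleftrightarrow> (q i = j) \<noteq> (q j = i)"
  using parity odd_edge_count_doubleton by metis

lemma same_or_reversed:
  assumes "i \<in> A" "p (p i) \<noteq> i"
  shows "q i = p i \<or> q (p i) = i" and "q (q i) \<noteq> i"
proof -
  have images: "p i \<in> A" "q i \<in> A" "i \<noteq> p i"
    using assms bij_betwE[OF bij_p] bij_betwE[OF bij_q] by auto
  have exclusive: "q i = p i \<longleftrightarrow> q (p i) \<noteq> i"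
    using traversed_once_iff[of i "p i"] assms images by auto
  then show "q i = p i \<or> q (p i) = i" by blast
  show "q (q i) \<noteq> i"
  proof
    assume "q (q i) = i"
    moreover have "q i = p i" if "q (p i) = q (q i)"
      using that images inj_onD[OF bij_betw_imp_inj_on[OF bij_q]] by metis
    ultimately show False
      using exclusive by auto
  qed
qed

lemma two_cycle_points_eq: "two_cycle_points A q = two_cycle_points A p"
  using loop_iff same_or_reversed(2) same_edge_parity.same_or_reversed(2)[OF swap]
  by (auto simp: two_cycle_points_def)

definition common_points :: "'a set" where
  "common_points = {i \<in> A - two_cycle_points A p. p i = q i}"

definition reversed_points :: "'a set" where
  "reversed_points = A - two_cycle_points A p - common_points"

lemma common_points_swap: "same_edge_parity.common_points A q p = common_points"
  unfolding common_points_def same_edge_parity.common_points_def[OF swap] two_cycle_points_eq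
  by auto

lemma reversed_points_swap: "same_edge_parity.reversed_points A q p = reversed_points"
  unfolding reversed_points_def same_edge_parity.reversed_points_def[OF swap]
    two_cycle_points_eq common_points_swap ..

lemma common_points_invariant: "p ` common_points \<subseteq> common_points"
proof
  fix j assume "j \<in> p ` common_points"
  then obtain i where common: "i \<in> A" "i \<notin> two_cycle_points A p" "q i = p i" "j = p i"
    by (auto simp: common_points_def)
  show "j \<in> common_points"
  proof (cases "p i = i")
    case True
    then show ?thesis using common by (simp add: common_points_def)
  next
    case False
    then have "p (p i) \<noteq> i" using common by (simp add: two_cycle_points_def)
    have inj: "p x = p y \<longleftrightarrow> x = y" "q x = q y \<longleftrightarrow> x = y" if "x \<in> A" "y \<in> A" for x y
      using that bij_p bij_q by (auto dest: bij_betw_imp_inj_on inj_onD)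
    have images: "p i \<in> A" "p (p i) \<in> A"
      using common(1) bij_betwE[OF bij_p] by auto
    have "p (p i) \<noteq> p i" "p (p (p i)) \<noteq> p i"
      using False \<open>p (p i) \<noteq> i\<close> inj(1) common(1) images by auto
    then have "q (p i) = p (p i) \<or> q (p (p i)) = p i"
      using same_or_reversed(1) images by blast
    moreover have "q (p (p i)) \<noteq> p i"
      using common(1,3) images \<open>p (p i) \<noteq> i\<close> inj(2) by metis
    ultimately show ?thesis
      using images \<open>p (p (p i)) \<noteq> p i\<close> common(4)
      by (simp add: common_points_def two_cycle_points_def)
  qed
qed

lemma q_inverse_on_reversed_points: "i \<in> reversed_points \<Longrightarrow> q (p i) = i"
  using same_or_reversed(1)[of i] loop_iff[of i]
  by (auto simp: reversed_points_def common_points_def two_cycle_points_def)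

lemma points_subset: "two_cycle_points A p \<subseteq> A" "common_points \<subseteq> A" "reversed_points \<subseteq> A"
  by (auto simp: two_cycle_points_def common_points_def reversed_points_def)

lemma bij_p_points:
  "bij_betw p (two_cycle_points A p) (two_cycle_points A p)"
  "bij_betw p common_points common_points"
  "bij_betw p reversed_points reversed_points"
proof -
  show two_cycle: "bij_betw p (two_cycle_points A p) (two_cycle_points A p)"
    using points_subset(1) bij_betw_imp_surj_on[OF bij_p]
    by (intro bij_betw_invariant_subset[OF finite bij_p] two_cycle_points_invariant) auto
  show common: "bij_betw p common_points common_points"
    by (rule bij_betw_invariant_subset[OF finite bij_p points_subset(2) common_points_invariant])
  show "bij_betw p reversed_points reversed_points"
    unfolding reversed_points_def
    by (intro bij_betw_DiffI bij_p two_cycle common)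
      (auto simp: common_points_def two_cycle_points_def)
qed

lemma leibniz_term_split:
  "leibniz_term M A p = leibniz_term M (two_cycle_points A p) p *
    (leibniz_term M common_points p * leibniz_term M reversed_points p)"
proof -
  have finite_parts: "finite (two_cycle_points A p)" "finite common_points" "finite reversed_points"
    using points_subset finite finite_subset by blast+
  have disjoint: "common_points \<inter> reversed_points = {}"
    "two_cycle_points A p \<inter> (common_points \<union> reversed_points) = {}"
    by (auto simp: common_points_def reversed_points_def)
  have partition: "two_cycle_points A p \<union> (common_points \<union> reversed_points) = A"
    using points_subset by (auto simp: reversed_points_def)
  have "leibniz_term M A p = leibniz_term M (two_cycle_points A p) p *
      leibniz_term M (common_points \<union> reversed_points) p"
    using leibniz_term_Un[OF finite_parts(1) finite_UnI[OF finite_parts(2,3)] disjoint(2)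
        bij_p_points(1) bij_betw_combine[OF bij_p_points(2,3) disjoint(1)], of M]
    by (simp only: partition)
  also have "leibniz_term M (common_points \<union> reversed_points) p =
      leibniz_term M common_points p * leibniz_term M reversed_points p"
    by (rule leibniz_term_Un[OF finite_parts(2,3) disjoint(1) bij_p_points(2,3)])
  finally show ?thesis .
qed

lemma leibniz_term_two_cycle_points:
  fixes M :: "'a \<Rightarrow> 'a \<Rightarrow> 'b :: linordered_idom"
  assumes "symmetric_on A M"
  shows "0 \<le> (- 1) ^ (card (two_cycle_points A p) div 2) * leibniz_term M (two_cycle_points A p) p"
proof (rule leibniz_term_involution)
  show "finite (two_cycle_points A p)"
    using points_subset(1) finite by (rule finite_subset)
  show "p ` two_cycle_points A p \<subseteq> two_cycle_points A p"
    using bij_betw_imp_surj_on[OF bij_p] by (intro two_cycle_points_invariant) simp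
  show "symmetric_on (two_cycle_points A p) M"
    using assms points_subset(1) by (rule symmetric_on_subset)
qed (simp add: two_cycle_points_def)

theorem leibniz_term_mult_nonneg:
  fixes M :: "'a \<Rightarrow> 'a \<Rightarrow> 'b :: linordered_idom"
  assumes sym: "symmetric_on A M"
  shows "0 \<le> leibniz_term M A p * leibniz_term M A q"
proof -
  let ?U = "two_cycle_points A p" and ?X = common_points and ?Y = reversed_points
  let ?t = "leibniz_term M"
  have "0 \<le> ((- 1) ^ (card ?U div 2) * ?t ?U p) * ((- 1) ^ (card ?U div 2) * ?t ?U q)"
    using leibniz_term_two_cycle_points[OF sym] two_cycle_points_eq
      same_edge_parity.leibniz_term_two_cycle_points[OF swap sym]
    by (intro mult_nonneg_nonneg[of "_ * ?t ?U p" "_ * ?t ?U q"]) auto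
  also have "\<dots> = ?t ?U p * ?t ?U q"
    by (cases "even (card ?U div 2)") simp_all
  finally have two_cycle: "0 \<le> ?t ?U p * ?t ?U q" .
  have common: "?t ?X q = ?t ?X p"
    by (rule leibniz_term_cong) (simp add: common_points_def)
  have reversed: "?t ?Y q = ?t ?Y p"
    using finite_subset[OF points_subset(3) finite] bij_p_points(3) q_inverse_on_reversed_points
      symmetric_on_subset[OF sym points_subset(3)]
    by (rule leibniz_term_inverse)
  have "?t A p * ?t A q = (?t ?U p * ?t ?U q) * ((?t ?X p)\<^sup>2 * (?t ?Y p)\<^sup>2)"
    using leibniz_term_split[of M] same_edge_parity.leibniz_term_split[OF swap, of M]
    by (simp add: two_cycle_points_eq common_points_swap reversed_points_swap common reversed
        power2_eq_square mult_ac)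
  with two_cycle show ?thesis by simp
qed

end

section \<open>Averaging over symmetric signings\<close>

definition edges_on :: "'a set \<Rightarrow> 'a set set" where
  "edges_on A = (\<lambda>(i, j). {i, j}) ` (A \<times> A)"

lemma doubleton_in_edges_on: "i \<in> A \<Longrightarrow> j \<in> A \<Longrightarrow> {i, j} \<in> edges_on A"
  by (auto simp: edges_on_def)

lemma finite_edges_on: "finite A \<Longrightarrow> finite (edges_on A)"
  by (simp add: edges_on_def)

lemma edge_count_eq_0:
  assumes "p ` A \<subseteq> A" "e \<notin> edges_on A"
  shows "edge_count A p e = 0"
proof -
  have "{i, p i} \<noteq> e" if "i \<in> A" for i
    using assms doubleton_in_edges_on[OF that, of "p i"] that by auto
  then have "{i \<in> A. {i, p i} = e} = {}" by blast
  then show ?thesis by (simp only: edge_count_def card.empty)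
qed

definition flip_sign :: "'a set set \<Rightarrow> 'a \<Rightarrow> 'a \<Rightarrow> 'b :: comm_ring_1" where
  "flip_sign F i j = (if {i, j} \<in> F then - 1 else 1)"

lemma prod_flip_sign:
  assumes "finite A" "p ` A \<subseteq> A"
  shows "(\<Prod>i\<in>A. flip_sign F i (p i))
    = (\<Prod>e\<in>edges_on A. if e \<in> F then (- 1) ^ edge_count A p e else 1)"
proof -
  have "(\<lambda>i. {i, p i}) ` A \<subseteq> edges_on A"
    using assms(2) by (auto simp: image_subset_iff doubleton_in_edges_on)
  then have "(\<Prod>i\<in>A. flip_sign F i (p i))
      = (\<Prod>e\<in>edges_on A. \<Prod>i\<in>{i \<in> A. {i, p i} = e}. flip_sign F i (p i))"
    using assms(1) by (intro prod.group[symmetric] finite_edges_on)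
  also have "\<dots> = (\<Prod>e\<in>edges_on A. if e \<in> F then (- 1) ^ edge_count A p e else 1)"
    by (intro prod.cong refl) (simp add: flip_sign_def edge_count_def)
  finally show ?thesis .
qed

lemma sum_Pow_prod_if:
  fixes x :: "'a \<Rightarrow> 'b :: comm_semiring_1"
  assumes "finite E"
  shows "(\<Sum>F\<in>Pow E. \<Prod>e\<in>E. if e \<in> F then x e else 1) = (\<Prod>e\<in>E. x e + 1)"
proof -
  have "(\<Prod>e\<in>E. if e \<in> F then x e else 1) = prod x F * (\<Prod>e\<in>E - F. 1)" if "F \<in> Pow E" for F
    using that assms by (simp add: prod.If_cases Int_absorb1)
  then show ?thesis by (simp add: prod_add[OF assms])
qed

definition parity_weight :: "'a set \<Rightarrow> ('a \<Rightarrow> 'a) \<Rightarrow> ('a \<Rightarrow> 'a) \<Rightarrow> 'b :: comm_ring_1" where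
  "parity_weight A p q = (\<Prod>e\<in>edges_on A. (- 1) ^ (edge_count A p e + edge_count A q e) + 1)"

lemma sum_flip_sign_prods:
  assumes "finite A" "p ` A \<subseteq> A" "q ` A \<subseteq> A"
  shows "(\<Sum>F\<in>Pow (edges_on A). (\<Prod>i\<in>A. flip_sign F i (p i)) * (\<Prod>i\<in>A. flip_sign F i (q i)))
    = (parity_weight A p q :: 'b :: comm_ring_1)"
  unfolding parity_weight_def prod_flip_sign[OF assms(1,2)] prod_flip_sign[OF assms(1,3)]
    sum_Pow_prod_if[OF finite_edges_on[OF assms(1)], symmetric] prod.distrib[symmetric]
  by (intro sum.cong prod.cong refl) (simp add: power_add)

lemma parity_weight_nonneg: "0 \<le> (parity_weight A p q :: 'b :: linordered_idom)"
  unfolding parity_weight_def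
proof (rule prod_nonneg)
  show "0 \<le> (- 1 :: 'b) ^ (edge_count A p e + edge_count A q e) + 1" for e
    by (cases "even (edge_count A p e + edge_count A q e)") simp_all
qed

lemma parity_weight_self_pos: "0 < (parity_weight A p p :: 'b :: linordered_idom)"
  unfolding parity_weight_def by (rule prod_pos) simp

lemma same_edge_parityI:
  assumes "finite A" "bij_betw p A A" "bij_betw q A A"
    and weight: "parity_weight A p q \<noteq> (0 :: 'b :: linordered_idom)"
  shows "same_edge_parity A p q"
proof
  fix e
  show "odd (edge_count A p e) \<longleftrightarrow> odd (edge_count A q e)"
  proof (cases "e \<in> edges_on A")
    case True
    then have "(- 1 :: 'b) ^ (edge_count A p e + edge_count A q e) + 1 \<noteq> 0"
      using weight
      unfolding parity_weight_def prod_zero_iff[OF finite_edges_on[OF assms(1)]] by blast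
    then show ?thesis
      by (cases "even (edge_count A p e + edge_count A q e)") auto
  next
    case False
    then show ?thesis
      using assms(2,3) by (simp add: edge_count_eq_0 bij_betw_imp_surj_on)
  qed
qed fact+

lemma sum_flip_sign_leibniz_terms:
  assumes "finite A" and q: "q permutes A"
  shows "(\<Sum>F\<in>Pow (edges_on A). (\<Prod>i\<in>A. flip_sign F i (q i)) *
      (\<Sum>p | p permutes A. leibniz_term M A p * (\<Prod>i\<in>A. flip_sign F i (p i))))
    = (\<Sum>p | p permutes A. leibniz_term M A p * parity_weight A q p)"
proof -
  let ?t = "leibniz_term M A" and ?c = "\<lambda>F p. \<Prod>i\<in>A. flip_sign F i (p i)"
  have "(\<Sum>F\<in>Pow (edges_on A). ?c F q * (\<Sum>p | p permutes A. ?t p * ?c F p))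
      = (\<Sum>F\<in>Pow (edges_on A). \<Sum>p | p permutes A. ?t p * (?c F q * ?c F p))"
    unfolding sum_distrib_left by (simp only: mult.left_commute)
  also have "\<dots> = (\<Sum>p | p permutes A. ?t p * parity_weight A q p)"
    by (subst sum.swap)
      (simp add: sum_distrib_left[symmetric] sum_flip_sign_prods assms permutes_image)
  finally show ?thesis .
qed

lemma leibniz_terms_parity_weight_nonneg:
  fixes M :: "'a \<Rightarrow> 'a \<Rightarrow> 'b :: linordered_idom"
  assumes "finite A" "symmetric_on A M" "p permutes A" "q permutes A"
  shows "0 \<le> leibniz_term M A q * leibniz_term M A p * parity_weight A q p"
proof (cases "parity_weight A q p = (0 :: 'b)")
  case False
  then have "same_edge_parity A q p"
    using assms by (intro same_edge_parityI permutes_imp_bij)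
  then have "0 \<le> leibniz_term M A q * leibniz_term M A p"
    using assms(2) by (rule same_edge_parity.leibniz_term_mult_nonneg)
  then show ?thesis
    using parity_weight_nonneg by (rule mult_nonneg_nonneg)
qed simp

theorem ex_flip_sign_leibniz_sum_nonzero:
  fixes M :: "'a \<Rightarrow> 'a \<Rightarrow> 'b :: linordered_idom"
  assumes "finite A" "symmetric_on A M" and q: "q permutes A" "\<And>i. i \<in> A \<Longrightarrow> M i (q i) \<noteq> 0"
  shows "\<exists>F. (\<Sum>p | p permutes A. leibniz_term M A p * (\<Prod>i\<in>A. flip_sign F i (p i))) \<noteq> 0"
proof (rule ccontr)
  let ?t = "leibniz_term M A"
  assume "\<nexists>F. (\<Sum>p | p permutes A. ?t p * (\<Prod>i\<in>A. flip_sign F i (p i))) \<noteq> 0"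
  then have "(\<Sum>p | p permutes A. ?t p * parity_weight A q p) = 0"
    unfolding sum_flip_sign_leibniz_terms[OF assms(1) q(1), symmetric] by simp
  have "?t q \<noteq> 0"
    using q(2) assms(1) by (simp add: leibniz_term_permutes[OF q(1)])
  then have "0 < ?t q * ?t q"
    by (auto simp: zero_less_mult_iff neq_iff)
  then have "0 < ?t q * ?t q * parity_weight A q q"
    using parity_weight_self_pos by (rule mult_pos_pos)
  also have "\<dots> \<le> (\<Sum>p | p permutes A. ?t q * ?t p * parity_weight A q p)"
    using leibniz_terms_parity_weight_nonneg[OF assms(1,2) _ q(1)] q(1) assms(1)
    by (intro member_le_sum) (auto simp: finite_permutations)
  also have "\<dots> = ?t q * (\<Sum>p | p permutes A. ?t p * parity_weight A q p)"
    by (simp only: sum_distrib_left mult.assoc)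
  finally show False
    using \<open>(\<Sum>p | p permutes A. ?t p * parity_weight A q p) = 0\<close> by simp
qed

definition flip_mat :: "nat \<Rightarrow> nat set set \<Rightarrow> real mat" where
  "flip_mat n F = mat n n (\<lambda>(i, j). flip_sign F i j)"

lemma flip_mat_symmetric_signing: "signing n (flip_mat n F)" "symmetric_mat (flip_mat n F)"
  by (auto simp: signing_def symmetric_mat_def flip_mat_def flip_sign_def insert_commute
      intro!: eq_matI)

lemma invertible_mat_iff_det:
  fixes A :: "'a :: field mat"
  assumes "A \<in> carrier_mat n n"
  shows "invertible_mat A \<longleftrightarrow> det A \<noteq> 0"
proof
  assume "invertible_mat A"
  then obtain B where inverse: "A * B = 1\<^sub>m n" "B * A = 1\<^sub>m (dim_row B)"
    using assms by (auto simp: invertible_mat_def inverts_mat_def)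
  then have "dim_col B = n" "dim_row B = n"
    using assms by (metis carrier_matD(2) index_mult_mat(3) index_one_mat(3))+
  then have "det A * det B = det (1\<^sub>m n :: 'a mat)"
    using det_mult[OF assms] inverse(1) by (metis carrier_matI)
  then show "det A \<noteq> 0" by auto
next
  assume "det A \<noteq> 0"
  from det_non_zero_imp_unit[OF assms this]
  obtain B where "B \<in> carrier_mat n n" "B * A = 1\<^sub>m n" "A * B = 1\<^sub>m n"
    by (auto simp: Units_def ring_mat_def)
  then show "invertible_mat A"
    using assms by (auto simp: invertible_mat_def inverts_mat_def)
qed

lemma signed_mat_carrier: "M \<in> carrier_mat n m \<Longrightarrow> signed_mat M s \<in> carrier_mat n m"
  by (simp add: signed_mat_def)

lemma det_signed_mat:
  assumes "M \<in> carrier_mat n n"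
  shows "det (signed_mat M s) = (\<Sum>p | p permutes {..<n}.
    leibniz_term (\<lambda>i j. M $$ (i, j)) {..<n} p * (\<Prod>i<n. s $$ (i, p i)))"
proof -
  have "det (signed_mat M s) =
      (\<Sum>p | p permutes {..<n}. of_int (sign p) * (\<Prod>i<n. signed_mat M s $$ (i, p i)))"
    using det_def'[OF signed_mat_carrier[OF assms]] by (simp add: atLeast0LessThan)
  moreover have
    "(\<Prod>i<n. signed_mat M s $$ (i, p i)) = (\<Prod>i<n. M $$ (i, p i)) * (\<Prod>i<n. s $$ (i, p i))"
    if "p permutes {..<n}" for p
    unfolding prod.distrib[symmetric]
    by (intro prod.cong refl) (use assms permutes_in_image[OF that] in \<open>auto simp: signed_mat_def\<close>)
  ultimately show ?thesis
    by (simp add: leibniz_term_permutes mult.assoc)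
qed

lemma det_signed_mat_nonzero_imp_permutation:
  assumes "M \<in> carrier_mat n n" "det (signed_mat M s) \<noteq> 0"
  shows "\<exists>q. q permutes {..<n} \<and> (\<forall>i<n. M $$ (i, q i) \<noteq> 0)"
proof -
  obtain q where "q permutes {..<n}" "leibniz_term (\<lambda>i j. M $$ (i, j)) {..<n} q \<noteq> 0"
    using assms(2) unfolding det_signed_mat[OF assms(1)]
    by (metis (no_types, lifting) mem_Collect_eq mult_zero_left sum.neutral)
  then show ?thesis
    by (auto simp: leibniz_term_permutes)
qed

lemma permutation_imp_det_flip_mat_nonzero:
  assumes carrier: "M \<in> carrier_mat n n" and "symmetric_mat M"
    and q: "q permutes {..<n}" "\<And>i. i < n \<Longrightarrow> M $$ (i, q i) \<noteq> 0"
  shows "\<exists>F. det (signed_mat M (flip_mat n F)) \<noteq> 0"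
proof -
  let ?M = "\<lambda>i j. M $$ (i, j)"
  have "M $$ (i, j) = M $$ (j, i)" if "i < n" "j < n" for i j
    using assms(1,2) that by (metis carrier_matD index_transpose_mat(1) symmetric_mat_def)
  then have "symmetric_on {..<n} ?M"
    by (simp add: symmetric_on_def)
  then obtain F where
    "(\<Sum>p | p permutes {..<n}. leibniz_term ?M {..<n} p * (\<Prod>i<n. flip_sign F i (p i))) \<noteq> 0"
    using ex_flip_sign_leibniz_sum_nonzero[of "{..<n}" ?M q] q by auto
  moreover have "(\<Prod>i<n. flip_sign F i (p i)) = (\<Prod>i<n. flip_mat n F $$ (i, p i))"
    if "p permutes {..<n}" for p
    using permutes_in_image[OF that] by (intro prod.cong) (auto simp: flip_mat_def)
  ultimately show ?thesis
    by (auto simp: det_signed_mat[OF carrier])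
qed

theorem invertible_signing_iff_permutation:
  assumes "symmetric_mat M" "dim_row M = n"
  shows "invertible_signing M \<longleftrightarrow> (\<exists>q. q permutes {..<n} \<and> (\<forall>i<n. M $$ (i, q i) \<noteq> 0))"
proof -
  have carrier: "M \<in> carrier_mat n n"
    using assms by (auto simp: symmetric_mat_def)
  then have "invertible_mat (signed_mat M s) \<longleftrightarrow> det (signed_mat M s) \<noteq> 0" for s
    by (intro invertible_mat_iff_det signed_mat_carrier)
  then have det_iff:
    "invertible_signing M \<longleftrightarrow> (\<exists>s. signing n s \<and> symmetric_mat s \<and> det (signed_mat M s) \<noteq> 0)"
    by (simp add: invertible_signing_def assms(2))
  show ?thesis
  proof
    assume "invertible_signing M"
    then show "\<exists>q. q permutes {..<n} \<and> (\<forall>i<n. M $$ (i, q i) \<noteq> 0)"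
      unfolding det_iff using det_signed_mat_nonzero_imp_permutation[OF carrier] by auto
  next
    assume "\<exists>q. q permutes {..<n} \<and> (\<forall>i<n. M $$ (i, q i) \<noteq> 0)"
    then obtain F where "det (signed_mat M (flip_mat n F)) \<noteq> 0"
      using permutation_imp_det_flip_mat_nonzero[OF carrier assms(1)] by auto
    then show "invertible_signing M"
      unfolding det_iff using flip_mat_symmetric_signing by blast
  qed
qed

section \<open>Matchings by auction\<close>

definition matchable :: "('r \<Rightarrow> 'c \<Rightarrow> bool) \<Rightarrow> 'r set \<Rightarrow> 'c set \<Rightarrow> bool" where
  "matchable E R C \<longleftrightarrow> (\<exists>f. inj_on f R \<and> (\<forall>i\<in>R. f i \<in> C \<and> E i (f i)))"

lemma matchable_self_iff_permutes:
  assumes "finite A"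
  shows "matchable E A A \<longleftrightarrow> (\<exists>q. q permutes A \<and> (\<forall>i\<in>A. E i (q i)))"
proof
  assume "matchable E A A"
  then obtain f where matching: "inj_on f A" "\<And>i. i \<in> A \<Longrightarrow> f i \<in> A \<and> E i (f i)"
    by (auto simp: matchable_def)
  then have "bij_betw f A A"
    using endo_inj_surj[OF assms _ matching(1)] by (auto simp: bij_betw_def)
  then have "restrict_id f A permutes A"
    by (rule permutes_restrict_id)
  then show "\<exists>q. q permutes A \<and> (\<forall>i\<in>A. E i (q i))"
    using matching by (intro exI[of _ "restrict_id f A"]) simp
next
  assume "\<exists>q. q permutes A \<and> (\<forall>i\<in>A. E i (q i))"
  then show "matchable E A A"
    unfolding matchable_def using permutes_inj_on permutes_in_image by metis
qed

definition neighbours :: "('r \<Rightarrow> 'c \<Rightarrow> bool) \<Rightarrow> 'c set \<Rightarrow> 'r set \<Rightarrow> 'c set" where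
  "neighbours E C S = {j \<in> C. \<exists>i\<in>S. E i j}"

lemma not_matchable_if_card_neighbours_less:
  assumes "finite C" "S \<subseteq> R" "card (neighbours E C S) < card S"
  shows "\<not> matchable E R C"
proof
  assume "matchable E R C"
  then obtain f where matching: "inj_on f R" "\<And>i. i \<in> R \<Longrightarrow> f i \<in> C \<and> E i (f i)"
    by (auto simp: matchable_def)
  have "card S \<le> card (neighbours E C S)"
    using inj_on_subset[OF matching(1) assms(2)] matching(2) assms(1,2)
    by (intro card_inj_on_le[of f]) (auto simp: neighbours_def)
  with assms(3) show False by simp
qed

text \<open>The columns \<open>C\<close> have prices \<open>p\<close> and owners \<open>m\<close>. The last condition is complementary
  slackness: no owner has a neighbouring column that is cheaper by more than 1.\<close>

definition auction :: "('r \<Rightarrow> 'c \<Rightarrow> bool) \<Rightarrow> 'c set \<Rightarrow> ('c \<Rightarrow> nat) \<Rightarrow> ('c \<rightharpoonup> 'r) \<Rightarrow> bool" where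
  "auction E C p m \<longleftrightarrow>
     dom m \<subseteq> C \<and> inj_on m (dom m) \<and>
     (\<forall>j\<in>C - dom m. p j = 0) \<and>
     (\<forall>i j. m j = Some i \<longrightarrow> E i j \<and> (\<forall>k\<in>C. E i k \<longrightarrow> p j \<le> Suc (p k)))"

lemma auction_init: "auction E C (\<lambda>_. 0) Map.empty"
  by (simp add: auction_def)

lemma inj_on_dom_map_upd:
  "inj_on m (dom m) \<Longrightarrow> y \<notin> ran m \<Longrightarrow> inj_on (m(x \<mapsto> y)) (dom (m(x \<mapsto> y)))"
  by (auto simp: inj_on_def ran_def dom_def)

definition cheapest_column :: "('r \<Rightarrow> 'c \<Rightarrow> bool) \<Rightarrow> 'c set \<Rightarrow> ('c \<Rightarrow> nat) \<Rightarrow> 'r \<Rightarrow> 'c \<Rightarrow> bool" where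
  "cheapest_column E C p i b \<longleftrightarrow> b \<in> C \<and> E i b \<and> (\<forall>k\<in>C. E i k \<longrightarrow> p b \<le> p k)"

abbreviation raise_price :: "('c \<Rightarrow> nat) \<Rightarrow> 'c \<Rightarrow> 'c \<Rightarrow> nat" where
  "raise_price p b \<equiv> p(b := Suc (p b))"

lemma auction_bid:
  assumes auction: "auction E C p m" and "i \<notin> ran m" and cheapest: "cheapest_column E C p i b"
  shows "auction E C (raise_price p b) (m(b \<mapsto> i))"
  unfolding auction_def
proof (intro conjI allI impI)
  show "dom (m(b \<mapsto> i)) \<subseteq> C"
    using auction cheapest by (simp add: auction_def cheapest_column_def)
  show "inj_on (m(b \<mapsto> i)) (dom (m(b \<mapsto> i)))"
    using auction \<open>i \<notin> ran m\<close> by (intro inj_on_dom_map_upd) (simp_all add: auction_def)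
  show "\<forall>j\<in>C - dom (m(b \<mapsto> i)). raise_price p b j = 0"
    using auction by (simp add: auction_def)
next
  fix x j assume owner: "(m(b \<mapsto> i)) j = Some x"
  show "E x j"
    using owner auction cheapest by (auto simp: auction_def cheapest_column_def split: if_splits)
  show "\<forall>k\<in>C. E x k \<longrightarrow> raise_price p b j \<le> Suc (raise_price p b k)"
  proof (cases "j = b")
    case True
    then show ?thesis using owner cheapest by (auto simp: cheapest_column_def)
  next
    case False
    then have "\<forall>k\<in>C. E x k \<longrightarrow> p j \<le> Suc (p k)"
      using owner auction by (simp add: auction_def)
    then show ?thesis using False by (auto intro: le_SucI)
  qed
qed

lemma auction_matchable:
  assumes "auction E C p m"
  shows "matchable E (ran m) C"
proof -
  have "\<forall>i\<in>ran m. \<exists>j. m j = Some i"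
    by (simp add: ran_def)
  from bchoice[OF this] obtain f where owned: "\<And>i. i \<in> ran m \<Longrightarrow> m (f i) = Some i"
    by blast
  have "inj_on f (ran m)"
    by (rule inj_onI) (metis owned option.inject)
  moreover have "f i \<in> C \<and> E i (f i)" if "i \<in> ran m" for i
    using owned[OF that] assms by (auto simp: auction_def)
  ultimately show ?thesis
    unfolding matchable_def by blast
qed

lemma ex_unattained_level:
  fixes p :: "'c \<Rightarrow> nat"
  assumes "finite C"
  shows "\<exists>g \<le> card C. g \<notin> p ` C"
proof -
  have "\<not> {..card C} \<subseteq> p ` C"
    using card_mono[of "p ` C" "{..card C}"] card_image_le[OF assms, of p] assms by auto
  then show ?thesis by auto
qed

lemma inj_on_the_map:
  assumes "inj_on m (dom m)" "A \<subseteq> dom m"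
  shows "inj_on (\<lambda>x. the (m x)) A"
proof (rule inj_onI)
  fix x y assume "x \<in> A" "y \<in> A" and eq: "the (m x) = the (m y)"
  then have "x \<in> dom m" "y \<in> dom m"
    using assms(2) by auto
  moreover from this have "m x = m y"
    using eq by auto
  ultimately show "x = y"
    using assms(1) by (simp add: inj_on_eq_iff)
qed

lemma auction_neighbours_above_level:
  assumes "auction E C p m" "g \<notin> p ` C" "m j = Some x" "g < p j"
  shows "neighbours E C {x} \<subseteq> {k \<in> C. g < p k}"
proof
  fix k assume "k \<in> neighbours E C {x}"
  then have "k \<in> C" "p j \<le> Suc (p k)"
    using assms(1,3) by (auto simp: neighbours_def auction_def)
  moreover from \<open>k \<in> C\<close> have "p k \<noteq> g"
    using assms(2) by blast
  ultimately show "k \<in> {k \<in> C. g < p k}"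
    using assms(4) by simp
qed

text \<open>The set \<open>S\<close> consists of \<open>i\<close> and the owners of the columns above an unattained price level.\<close>

lemma auction_deficient:
  assumes auction: "auction E C p m" and "finite C" "i \<notin> ran m"
    and expensive: "\<And>k. k \<in> C \<Longrightarrow> E i k \<Longrightarrow> card C < p k"
  shows "\<exists>S \<subseteq> insert i (ran m). card (neighbours E C S) < card S"
proof -
  obtain g where level: "g \<le> card C" "g \<notin> p ` C"
    using ex_unattained_level[OF \<open>finite C\<close>] by blast
  define T where "T = {j \<in> C. g < p j}"
  define S where "S = insert i ((\<lambda>j. the (m j)) ` T)"
  have "p j = 0" if "j \<in> C - dom m" for j
    using auction that unfolding auction_def by blast
  then have "T \<subseteq> dom m"
    unfolding T_def by fastforce
  have "inj_on (\<lambda>j. the (m j)) T"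
    using auction \<open>T \<subseteq> dom m\<close> by (intro inj_on_the_map) (simp_all add: auction_def)
  moreover have owners: "(\<lambda>j. the (m j)) ` T \<subseteq> ran m"
    using \<open>T \<subseteq> dom m\<close> by (force intro: ranI)
  moreover have "finite T"
    using \<open>finite C\<close> by (simp add: T_def)
  ultimately have "card T < card S"
    using \<open>i \<notin> ran m\<close> by (auto simp: S_def card_image card_insert_if)
  have "neighbours E C {x} \<subseteq> T" if "x \<in> S" for x
  proof (cases "x = i")
    case True
    then show ?thesis
      using expensive le_less_trans[OF level(1)] by (auto simp: neighbours_def T_def)
  next
    case False
    then obtain j where "j \<in> T" "m j = Some x"
      using \<open>x \<in> S\<close> \<open>T \<subseteq> dom m\<close> by (auto simp: S_def)
    then show ?thesis
      using auction_neighbours_above_level[OF auction level(2)] by (simp add: T_def)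
  qed
  then have "neighbours E C S \<subseteq> T"
    by (auto simp: neighbours_def)
  then have "card (neighbours E C S) \<le> card T"
    using \<open>finite T\<close> by (rule card_mono[rotated])
  moreover have "S \<subseteq> insert i (ran m)"
    using owners by (auto simp: S_def)
  ultimately show ?thesis
    using \<open>card T < card S\<close> by (intro exI[of _ S]) simp
qed

text \<open>Once \<open>u = n\<close>, every row owns a column and \<open>i = n\<close> stands for the absence of a bidding row.\<close>

definition bidding ::
  "nat \<Rightarrow> (nat \<Rightarrow> nat \<Rightarrow> bool) \<Rightarrow> nat \<Rightarrow> nat \<Rightarrow> (nat \<Rightarrow> nat) \<Rightarrow> (nat \<rightharpoonup> nat) \<Rightarrow> bool" where
  "bidding n E u i p m \<longleftrightarrow>
     auction E {..<n} p m \<and> ran m = {..u} - {i} \<and> i \<le> u \<and> u \<le> n \<and> (u = n \<longrightarrow> i = n)"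

lemma bidding_init: "bidding n E 0 0 (\<lambda>_. 0) Map.empty"
  by (auto simp: bidding_def auction_init)

lemma bidding_auction_bid:
  assumes "bidding n E u i p m" "cheapest_column E {..<n} p i b"
  shows "auction E {..<n} (raise_price p b) (m(b \<mapsto> i))"
proof (rule auction_bid)
  show "auction E {..<n} p m" "i \<notin> ran m"
    using assms(1) by (auto simp: bidding_def)
qed (rule assms(2))

lemma bidding_unowned:
  assumes "bidding n E u i p m" "u < n" "cheapest_column E {..<n} p i b" "m b = None"
  shows "bidding n E (Suc u) (Suc u) (raise_price p b) (m(b \<mapsto> i))"
proof -
  have "ran (m(b \<mapsto> i)) = insert i ({..u} - {i})" "i \<le> u"
    using assms(1,4) by (simp_all add: bidding_def)
  moreover have "insert i ({..u} - {i}) = {..Suc u} - {Suc u}" if "i \<le> u"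
    using that by auto
  ultimately show ?thesis
    using bidding_auction_bid[OF assms(1,3)] assms(2) by (simp add: bidding_def)
qed

lemma bidding_owned:
  assumes "bidding n E u i p m" "u < n" "cheapest_column E {..<n} p i b" "m b = Some i'"
  shows "bidding n E u i' (raise_price p b) (m(b \<mapsto> i))"
proof -
  have "inj_on m (dom m)" "i \<notin> ran m" "ran m = {..u} - {i}" "i \<le> u"
    using assms(1) by (auto simp: bidding_def auction_def)
  with assms(4) have "ran (m(b \<mapsto> i)) = {..u} - {i} - {i'} \<union> {i}"
    using ran_map_upd_Some[of m b i' i] by simp
  moreover have "i' \<in> {..u} - {i}"
    using ranI[of m b i'] assms(4) \<open>ran m = {..u} - {i}\<close> by simp
  moreover from this have "{..u} - {i} - {i'} \<union> {i} = {..u} - {i'}"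
    using \<open>i \<le> u\<close> by auto
  ultimately show ?thesis
    using bidding_auction_bid[OF assms(1,3)] assms(2) by (simp add: bidding_def)
qed

lemma bidding_stuck:
  assumes "bidding n E u i p m" "u < n" "\<And>k. k < n \<Longrightarrow> E i k \<Longrightarrow> n < p k"
  shows "\<not> matchable E {..<n} {..<n}"
proof -
  have "auction E {..<n} p m" "i \<notin> ran m"
    using assms(1) by (auto simp: bidding_def)
  then have "\<exists>S \<subseteq> insert i (ran m). card (neighbours E {..<n} S) < card S"
    by (rule auction_deficient[OF _ finite_lessThan]) (use assms(3) in simp)
  then obtain S where violator: "S \<subseteq> insert i (ran m)" "card (neighbours E {..<n} S) < card S"
    by blast
  have "S \<subseteq> {..<n}"
    using violator(1) assms(1,2) by (auto simp: bidding_def)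
  with violator(2) show ?thesis
    by (intro not_matchable_if_card_neighbours_less[of _ S]) simp_all
qed

lemma bidding_finished:
  assumes "bidding n E n i p m"
  shows "matchable E {..<n} {..<n}"
proof -
  have "ran m = {..n} - {n}" "auction E {..<n} p m"
    using assms by (auto simp: bidding_def)
  moreover have "{..n} - {n} = {..<n}" by auto
  ultimately show ?thesis
    using auction_matchable by metis
qed

definition price_slack :: "nat \<Rightarrow> (nat \<Rightarrow> nat) \<Rightarrow> nat" where
  "price_slack n p = (\<Sum>j<n. Suc n - p j)"

lemma price_slack_raise:
  assumes "b < n" "p b \<le> n"
  shows "price_slack n (raise_price p b) < price_slack n p"
  unfolding price_slack_def
proof (rule sum_strict_mono_ex1)
  show "\<exists>j\<in>{..<n}. Suc n - raise_price p b j < Suc n - p j"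
    using assms by (intro bexI[of _ b]) auto
qed (simp_all add: diff_le_mono)

section \<open>Weakest preconditions with cost\<close>

definition wp ::
  "(instr \<Rightarrow> state \<Rightarrow> nat) \<Rightarrow> (test \<Rightarrow> state \<Rightarrow> nat) \<Rightarrow> prog \<Rightarrow> (nat \<Rightarrow> state \<Rightarrow> bool) \<Rightarrow>
   state \<Rightarrow> bool" where
  "wp ic tc c Q \<sigma> \<longleftrightarrow> (\<exists>t \<tau>. exec ic tc c \<sigma> t \<tau> \<and> Q t \<tau>)"

abbreviation wp_unit :: "prog \<Rightarrow> (nat \<Rightarrow> state \<Rightarrow> bool) \<Rightarrow> state \<Rightarrow> bool" where
  "wp_unit \<equiv> wp (\<lambda>_ _. 1) (\<lambda>_ _. 1)"

inductive_cases exec_SkipE: "exec ic tc Skip \<sigma> t \<tau>"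
inductive_cases exec_DoE: "exec ic tc (Do i) \<sigma> t \<tau>"
inductive_cases exec_SeqE: "exec ic tc (Seq c d) \<sigma> t \<tau>"
inductive_cases exec_CondE: "exec ic tc (Cond b c d) \<sigma> t \<tau>"
inductive_cases exec_WhileE: "exec ic tc (While b c) \<sigma> t \<tau>"

lemma wp_mono: "wp ic tc c Q \<sigma> \<Longrightarrow> (\<And>t \<tau>. Q t \<tau> \<Longrightarrow> Q' t \<tau>) \<Longrightarrow> wp ic tc c Q' \<sigma>"
  unfolding wp_def by blast

lemma wp_Skip [simp]: "wp ic tc Skip Q \<sigma> \<longleftrightarrow> Q 1 \<sigma>"
  unfolding wp_def by (metis exec.Skip exec_SkipE)

lemma wp_Do [simp]: "wp ic tc (Do i) Q \<sigma> \<longleftrightarrow> Q (ic i \<sigma>) (exec_instr i \<sigma>)"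
  unfolding wp_def by (blast intro: exec.Do elim!: exec_DoE)

lemma wp_Seq [simp]:
  "wp ic tc (Seq c d) Q \<sigma> \<longleftrightarrow> wp ic tc c (\<lambda>t. wp ic tc d (\<lambda>u. Q (t + u))) \<sigma>"
  unfolding wp_def by (blast intro: exec.Seq elim!: exec_SeqE)

lemma wp_Cond [simp]:
  "wp ic tc (Cond b c d) Q \<sigma> \<longleftrightarrow>
     (if eval_test b \<sigma> then wp ic tc c (\<lambda>t. Q (tc b \<sigma> + t)) \<sigma>
      else wp ic tc d (\<lambda>t. Q (tc b \<sigma> + t)) \<sigma>)"
  unfolding wp_def by (auto intro: exec.Cond_True exec.Cond_False elim!: exec_CondE)

lemma wp_While_unfold:
  "wp ic tc (While b c) Q \<sigma> \<longleftrightarrow>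
     (if eval_test b \<sigma> then wp ic tc c (\<lambda>t. wp ic tc (While b c) (\<lambda>u. Q (tc b \<sigma> + t + u))) \<sigma>
      else Q (tc b \<sigma>) \<sigma>)"
proof
  assume "wp ic tc (While b c) Q \<sigma>"
  then obtain t \<tau> where "exec ic tc (While b c) \<sigma> t \<tau>" "Q t \<tau>"
    by (auto simp: wp_def)
  then show "if eval_test b \<sigma> then wp ic tc c (\<lambda>t. wp ic tc (While b c) (\<lambda>u. Q (tc b \<sigma> + t + u))) \<sigma>
      else Q (tc b \<sigma>) \<sigma>"
    by (cases rule: exec_WhileE) (auto simp: wp_def)
qed (auto simp: wp_def intro: exec.While_False exec.While_True split: if_splits)

lemma wp_unit_While:
  fixes f :: "state \<Rightarrow> nat"
  assumes step: "\<And>\<sigma>. I \<sigma> \<Longrightarrow> eval_test b \<sigma> \<Longrightarrow> wp_unit c (\<lambda>t \<tau>. t \<le> T \<and> I \<tau> \<and> f \<tau> < f \<sigma>) \<sigma>"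
    and "I \<sigma>"
  shows "wp_unit (While b c) (\<lambda>t \<tau>. t \<le> f \<sigma> * Suc T + 1 \<and> I \<tau> \<and> \<not> eval_test b \<tau>) \<sigma>"
  using assms(2)
proof (induction "f \<sigma>" arbitrary: \<sigma> rule: less_induct)
  case less
  show ?case
  proof (cases "eval_test b \<sigma>")
    case True
    have "wp_unit (While b c) (\<lambda>u \<rho>. 1 + t + u \<le> f \<sigma> * Suc T + 1 \<and> I \<rho> \<and> \<not> eval_test b \<rho>) \<tau>"
      if progress: "t \<le> T \<and> I \<tau> \<and> f \<tau> < f \<sigma>" for t \<tau>
    proof -
      have "Suc (f \<tau>) * Suc T \<le> f \<sigma> * Suc T"
        using progress by (intro mult_le_mono1) simp
      then have "1 + t + u \<le> f \<sigma> * Suc T + 1" if "u \<le> f \<tau> * Suc T + 1" for u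
        using that progress by simp
      then show ?thesis
        using progress less.hyps[of \<tau>] by (auto elim: wp_mono)
    qed
    with step[OF less.prems True] show ?thesis
      unfolding wp_While_unfold[of _ _ b c _ \<sigma>] if_P[OF True] by (rule wp_mono)
  next
    case False
    then show ?thesis
      using less.prems by (subst wp_While_unfold) simp
  qed
qed

fun block :: "instr list \<Rightarrow> prog" where
  "block [] = Skip"
| "block (i # xs) = Seq (Do i) (block xs)"

lemma wp_unit_block [simp]:
  "wp_unit (block xs) Q \<sigma> \<longleftrightarrow> Q (Suc (length xs)) (fold exec_instr xs \<sigma>)"
  by (induction xs arbitrary: Q \<sigma>) simp_all

section \<open>The matching program\<close>

abbreviation (input) copy :: "loc \<Rightarrow> nat_operand \<Rightarrow> instr" where
  "copy l a \<equiv> NAdd l a (NLit 0)"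

abbreviation (input) add_to :: "loc \<Rightarrow> nat_operand \<Rightarrow> instr" where
  "add_to l a \<equiv> NAdd l (NCell l) a"

text \<open>A row \<open>i\<close> is represented by the address \<open>i * n\<close> of its first entry, so that no multiplication
  is needed: \<open>row_reg\<close> holds \<open>i * n\<close> for the bidding row \<open>i\<close>, \<open>next_reg\<close> holds \<open>u * n\<close> for the
  number \<open>u\<close> in \<open>done_reg\<close>, and an owner \<open>i\<close> is stored as \<open>i * n + 1\<close>, with 0 for an unowned column.
  Cell 1 is skipped because simplification turns the address 1 into \<open>Suc 0\<close>.\<close>

abbreviation (input) size_reg :: nat where "size_reg \<equiv> 0"
abbreviation (input) done_reg :: nat where "done_reg \<equiv> 2"
abbreviation (input) row_reg :: nat where "row_reg \<equiv> 3"
abbreviation (input) next_reg :: nat where "next_reg \<equiv> 4"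
abbreviation (input) failed_reg :: nat where "failed_reg \<equiv> 5"
abbreviation (input) col_reg :: nat where "col_reg \<equiv> 6"
abbreviation (input) best_reg :: nat where "best_reg \<equiv> 7"
abbreviation (input) best_ptr :: nat where "best_ptr \<equiv> 8"
abbreviation (input) price_ptr :: nat where "price_ptr \<equiv> 9"
abbreviation (input) entry_ptr :: nat where "entry_ptr \<equiv> 10"
abbreviation (input) owner_reg :: nat where "owner_reg \<equiv> 11"
abbreviation (input) price_cell :: "nat \<Rightarrow> nat" where "price_cell j \<equiv> 12 + 2 * j"
abbreviation (input) owner_cell :: "nat \<Rightarrow> nat" where "owner_cell j \<equiv> 13 + 2 * j"

definition scan_step :: prog where
  "scan_step = Seq
     (Cond (REq (RCell (Ind entry_ptr)) (RLit 0)) Skip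
       (Cond (NLess (NCell (Ind price_ptr)) (NCell (Dir best_reg)))
         (block [copy (Dir best_reg) (NCell (Ind price_ptr)),
           copy (Dir best_ptr) (NCell (Dir price_ptr))])
         Skip))
     (block [add_to (Dir col_reg) (NLit 1), add_to (Dir price_ptr) (NLit 2),
       add_to (Dir entry_ptr) (NLit 1)])"

definition scan :: prog where
  "scan = Seq
     (block [copy (Dir col_reg) (NLit 0), NAdd (Dir best_reg) (NCell (Dir size_reg)) (NLit 1),
       copy (Dir price_ptr) (NLit (price_cell 0)), copy (Dir entry_ptr) (NCell (Dir row_reg))])
     (While (NLess (NCell (Dir col_reg)) (NCell (Dir size_reg))) scan_step)"

text \<open>Clearing \<open>size_reg\<close> ends the main loop.\<close>

definition report_failure :: prog where
  "report_failure = block [copy (Dir size_reg) (NLit 0), copy (Dir failed_reg) (NLit 1)]"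

definition place_bid :: prog where
  "place_bid = block [add_to (Ind best_ptr) (NLit 1), add_to (Dir best_ptr) (NLit 1),
     copy (Dir owner_reg) (NCell (Ind best_ptr)),
     NAdd (Ind best_ptr) (NCell (Dir row_reg)) (NLit 1)]"

definition select_bidder :: prog where
  "select_bidder = Cond (NEq (NCell (Dir owner_reg)) (NLit 0))
     (block [add_to (Dir done_reg) (NLit 1), add_to (Dir next_reg) (NCell (Dir size_reg)),
       copy (Dir row_reg) (NCell (Dir next_reg))])
     (block [NSub (Dir row_reg) (NCell (Dir owner_reg)) (NLit 1)])"

definition bid_or_fail :: prog where
  "bid_or_fail = Cond (NLess (NCell (Dir size_reg)) (NCell (Dir best_reg)))
     report_failure
     (Seq place_bid select_bidder)"

definition bid_step :: prog where
  "bid_step = Seq scan bid_or_fail"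

definition matching_prog :: prog where
  "matching_prog = Seq (While (NLess (NCell (Dir done_reg)) (NCell (Dir size_reg))) bid_step)
     (Do (NSub (Dir size_reg) (NLit 1) (NCell (Dir failed_reg))))"

text \<open>The value \<open>Suc n\<close> says that no offer in \<open>K\<close> is at most \<open>n\<close>; then \<open>k\<close> is arbitrary.\<close>

definition least_offer :: "nat \<Rightarrow> ('a \<Rightarrow> nat) \<Rightarrow> 'a set \<Rightarrow> nat \<Rightarrow> 'a \<Rightarrow> bool" where
  "least_offer n p K v k \<longleftrightarrow> v \<le> Suc n \<and> (\<forall>j\<in>K. v \<le> p j) \<and> (v \<le> n \<longrightarrow> k \<in> K \<and> p k = v)"

lemma least_offer_empty: "least_offer n p {} (Suc n) k"
  by (simp add: least_offer_def)

lemma least_offer_insert: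
  assumes "least_offer n p K v k"
  shows "v \<le> p j \<Longrightarrow> least_offer n p (insert j K) v k"
    and "p j < v \<Longrightarrow> least_offer n p (insert j K) (p j) j"
  using assms by (auto simp: least_offer_def)

definition row_edge :: "nat \<Rightarrow> (nat \<Rightarrow> real) \<Rightarrow> nat \<Rightarrow> nat \<Rightarrow> bool" where
  "row_edge n R i j \<longleftrightarrow> R (i * n + j) \<noteq> 0"

definition offers :: "state \<Rightarrow> nat \<Rightarrow> nat set" where
  "offers \<sigma> j = price_cell ` {k. k < j \<and> rmem \<sigma> (nmem \<sigma> row_reg + k) \<noteq> 0}"

lemma offers_0: "offers \<sigma> 0 = {}"
  by (simp add: offers_def)

lemma offers_Suc:
  "offers \<sigma> (Suc j) =
     (if rmem \<sigma> (nmem \<sigma> row_reg + j) = 0 then offers \<sigma> j else insert (price_cell j) (offers \<sigma> j))"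
  by (auto simp: offers_def less_Suc_eq)

definition scanned :: "state \<Rightarrow> state \<Rightarrow> bool" where
  "scanned \<sigma> \<tau> \<longleftrightarrow> rmem \<tau> = rmem \<sigma> \<and> (\<forall>x. x < col_reg \<or> entry_ptr < x \<longrightarrow> nmem \<tau> x = nmem \<sigma> x) \<and>
     nmem \<tau> col_reg \<le> nmem \<sigma> size_reg \<and>
     nmem \<tau> price_ptr = price_cell (nmem \<tau> col_reg) \<and>
     nmem \<tau> entry_ptr = nmem \<sigma> row_reg + nmem \<tau> col_reg \<and>
     least_offer (nmem \<sigma> size_reg) (nmem \<sigma>) (offers \<sigma> (nmem \<tau> col_reg))
       (nmem \<tau> best_reg) (nmem \<tau> best_ptr)"

lemma wp_scan_step:
  assumes "scanned \<sigma> \<tau>" "nmem \<tau> col_reg < nmem \<sigma> size_reg"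
  shows "wp_unit scan_step (\<lambda>t \<rho>. t \<le> 9 \<and> scanned \<sigma> \<rho> \<and> nmem \<rho> col_reg = Suc (nmem \<tau> col_reg)) \<tau>"
  using assms least_offer_insert[where p = "nmem \<sigma>" and j = "price_cell (nmem \<tau> col_reg)"]
  by (auto simp: scan_step_def scanned_def nat_store_def offers_Suc)

lemma wp_scan:
  "wp_unit scan
     (\<lambda>t \<tau>. t \<le> 10 * nmem \<sigma> size_reg + 6 \<and> scanned \<sigma> \<tau> \<and> nmem \<tau> col_reg = nmem \<sigma> size_reg) \<sigma>"
proof -
  let ?n = "nmem \<sigma> size_reg"
  let ?f = "\<lambda>\<tau>. ?n - nmem \<tau> col_reg"
  let ?test = "NLess (NCell (Dir col_reg)) (NCell (Dir size_reg))"
  have step: "wp_unit scan_step (\<lambda>t \<rho>. t \<le> 9 \<and> scanned \<sigma> \<rho> \<and> ?f \<rho> < ?f \<tau>) \<tau>"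
    if "scanned \<sigma> \<tau>" "eval_test ?test \<tau>" for \<tau>
  proof -
    have "nmem \<tau> col_reg < ?n" using that by (simp add: scanned_def)
    with wp_scan_step[OF that(1) this] show ?thesis by (auto elim: wp_mono)
  qed
  have "wp_unit (While ?test scan_step)
      (\<lambda>u \<rho>. 5 + u \<le> 10 * ?n + 6 \<and> scanned \<sigma> \<rho> \<and> nmem \<rho> col_reg = ?n) \<tau>"
    if "scanned \<sigma> \<tau>" "nmem \<tau> col_reg = 0" for \<tau>
    using wp_unit_While[of "scanned \<sigma>" ?test scan_step 9 ?f \<tau>, OF step that(1)] that(2)
    by (auto elim!: wp_mono simp: scanned_def)
  then show ?thesis
    by (simp add: scan_def nat_store_def scanned_def offers_0 least_offer_empty)
qed

fun owner_code :: "nat \<Rightarrow> nat option \<Rightarrow> nat" where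
  "owner_code n None = 0"
| "owner_code n (Some i) = Suc (i * n)"

definition auction_state ::
  "nat \<Rightarrow> (nat \<Rightarrow> real) \<Rightarrow> nat \<Rightarrow> nat \<Rightarrow> (nat \<Rightarrow> nat) \<Rightarrow> (nat \<rightharpoonup> nat) \<Rightarrow> state \<Rightarrow> bool" where
  "auction_state n R u i p m \<sigma> \<longleftrightarrow> rmem \<sigma> = R \<and> nmem \<sigma> size_reg = n \<and> nmem \<sigma> done_reg = u \<and>
     nmem \<sigma> row_reg = i * n \<and> nmem \<sigma> next_reg = u * n \<and> nmem \<sigma> failed_reg = 0 \<and>
     (\<forall>j. nmem \<sigma> (price_cell j) = p j \<and> nmem \<sigma> (owner_cell j) = owner_code n (m j)) \<and>
     bidding n (row_edge n R) u i p m"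

definition failed_state :: "nat \<Rightarrow> (nat \<Rightarrow> real) \<Rightarrow> state \<Rightarrow> bool" where
  "failed_state n R \<sigma> \<longleftrightarrow> nmem \<sigma> size_reg = 0 \<and> nmem \<sigma> failed_reg = 1 \<and>
     \<not> matchable (row_edge n R) {..<n} {..<n}"

definition matching_inv :: "nat \<Rightarrow> (nat \<Rightarrow> real) \<Rightarrow> state \<Rightarrow> bool" where
  "matching_inv n R \<sigma> \<longleftrightarrow> failed_state n R \<sigma> \<or> (\<exists>u i p m. auction_state n R u i p m \<sigma>)"

definition remaining_bids :: "nat \<Rightarrow> state \<Rightarrow> nat" where
  "remaining_bids n \<sigma> =
     (if nmem \<sigma> failed_reg = 0 then Suc (price_slack n (\<lambda>j. nmem \<sigma> (price_cell j))) else 0)"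

lemma remaining_bids_auction_state:
  "auction_state n R u i p m \<sigma> \<Longrightarrow> remaining_bids n \<sigma> = Suc (price_slack n p)"
  by (simp add: remaining_bids_def auction_state_def)

lemma scanned_auction_state:
  "scanned \<sigma> \<tau> \<Longrightarrow> auction_state n R u i p m \<sigma> \<Longrightarrow> auction_state n R u i p m \<tau>"
  by (simp add: scanned_def auction_state_def)

lemma offers_auction_state:
  "auction_state n R u i p m \<sigma> \<Longrightarrow> offers \<sigma> j = price_cell ` {k. k < j \<and> row_edge n R i k}"
  by (simp add: offers_def auction_state_def row_edge_def)

lemma least_offer_auction_state:
  assumes "auction_state n R u i p m \<sigma>" "least_offer n (nmem \<sigma>) (offers \<sigma> n) v a"
  shows "k < n \<Longrightarrow> row_edge n R i k \<Longrightarrow> v \<le> p k"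
    and "v \<le> n \<Longrightarrow> \<exists>b. cheapest_column (row_edge n R) {..<n} p i b \<and> a = price_cell b \<and> p b = v"
  using assms(2) assms(1) unfolding offers_auction_state[OF assms(1)]
  by (auto simp: least_offer_def auction_state_def cheapest_column_def)

lemma wp_bid_unowned:
  assumes "auction_state n R u i p m \<sigma>" "nmem \<sigma> best_ptr = price_cell b" "m b = None"
    and "bidding n (row_edge n R) (Suc u) (Suc u) (raise_price p b) (m(b \<mapsto> i))"
  shows "wp_unit (Seq place_bid select_bidder)
    (\<lambda>t \<tau>. t \<le> 10 \<and> auction_state n R (Suc u) (Suc u) (raise_price p b) (m(b \<mapsto> i)) \<tau>) \<sigma>"
  using assms
  by (auto simp: place_bid_def select_bidder_def nat_store_def auction_state_def)

lemma wp_bid_owned: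
  assumes "auction_state n R u i p m \<sigma>" "nmem \<sigma> best_ptr = price_cell b" "m b = Some i'"
    and "bidding n (row_edge n R) u i' (raise_price p b) (m(b \<mapsto> i))"
  shows "wp_unit (Seq place_bid select_bidder)
    (\<lambda>t \<tau>. t \<le> 10 \<and> auction_state n R u i' (raise_price p b) (m(b \<mapsto> i)) \<tau>) \<sigma>"
  using assms
  by (auto simp: place_bid_def select_bidder_def nat_store_def auction_state_def)

lemma wp_bid:
  assumes state: "auction_state n R u i p m \<sigma>" and "u < n" and ptr: "nmem \<sigma> best_ptr = price_cell b"
    and cheapest: "cheapest_column (row_edge n R) {..<n} p i b" and "p b \<le> n"
  shows "wp_unit (Seq place_bid select_bidder)
    (\<lambda>t \<tau>. t \<le> 10 \<and> matching_inv n R \<tau> \<and> remaining_bids n \<tau> < remaining_bids n \<sigma>) \<sigma>"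
proof -
  have bidding: "bidding n (row_edge n R) u i p m"
    using state by (simp add: auction_state_def)
  have "wp_unit (Seq place_bid select_bidder)
    (\<lambda>t \<tau>. t \<le> 10 \<and> (\<exists>u i m. auction_state n R u i (raise_price p b) m \<tau>)) \<sigma>"
  proof (cases "m b")
    case None
    have "bidding n (row_edge n R) (Suc u) (Suc u) (raise_price p b) (m(b \<mapsto> i))"
      using bidding \<open>u < n\<close> cheapest None by (rule bidding_unowned)
    from wp_bid_unowned[OF state ptr None this] show ?thesis
      by (rule wp_mono) blast
  next
    case (Some i')
    have "bidding n (row_edge n R) u i' (raise_price p b) (m(b \<mapsto> i))"
      using bidding \<open>u < n\<close> cheapest Some by (rule bidding_owned)
    from wp_bid_owned[OF state ptr Some this] show ?thesis
      by (rule wp_mono) blast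
  qed
  moreover have "price_slack n (raise_price p b) < price_slack n p"
    using cheapest \<open>p b \<le> n\<close> by (intro price_slack_raise) (simp_all add: cheapest_column_def)
  ultimately show ?thesis
    by (elim wp_mono)
      (auto simp: matching_inv_def remaining_bids_auction_state[OF state]
        remaining_bids_auction_state)
qed

lemma wp_report_failure:
  assumes "\<not> matchable (row_edge n R) {..<n} {..<n}"
  shows "wp_unit report_failure (\<lambda>t \<tau>. t \<le> 3 \<and> failed_state n R \<tau> \<and> remaining_bids n \<tau> = 0) \<sigma>"
  using assms by (simp add: report_failure_def failed_state_def remaining_bids_def nat_store_def)

lemma wp_bid_or_fail:
  assumes state: "auction_state n R u i p m \<sigma>" and "u < n"
    and scanned: "scanned \<sigma> \<tau>" "nmem \<tau> col_reg = n"
  shows "wp_unit bid_or_fail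
    (\<lambda>t \<rho>. t \<le> 11 \<and> matching_inv n R \<rho> \<and> remaining_bids n \<rho> < remaining_bids n \<sigma>) \<tau>"
proof -
  have state': "auction_state n R u i p m \<tau>"
    using scanned(1) state by (rule scanned_auction_state)
  have remaining: "remaining_bids n \<sigma> = remaining_bids n \<tau>" "0 < remaining_bids n \<tau>"
    using remaining_bids_auction_state[OF state] remaining_bids_auction_state[OF state'] by simp_all
  have "least_offer n (nmem \<sigma>) (offers \<sigma> n) (nmem \<tau> best_reg) (nmem \<tau> best_ptr)"
    using scanned state by (simp add: scanned_def auction_state_def)
  note best = least_offer_auction_state[OF state this]
  show ?thesis
  proof (cases "n < nmem \<tau> best_reg")
    case True
    then have "n < p k" if "k < n" "row_edge n R i k" for k
      using best(1)[OF that] by simp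
    moreover have "bidding n (row_edge n R) u i p m"
      using state by (simp add: auction_state_def)
    ultimately have "\<not> matchable (row_edge n R) {..<n} {..<n}"
      using \<open>u < n\<close> by (intro bidding_stuck)
    from wp_report_failure[OF this, of \<tau>] show ?thesis
      using True state' remaining
      by (auto simp: bid_or_fail_def auction_state_def matching_inv_def elim: wp_mono)
  next
    case False
    with best(2) obtain b where cheapest: "cheapest_column (row_edge n R) {..<n} p i b"
      and ptr: "nmem \<tau> best_ptr = price_cell b" and "p b \<le> n"
      by auto
    have "wp_unit (Seq place_bid select_bidder)
        (\<lambda>t \<rho>. t \<le> 10 \<and> matching_inv n R \<rho> \<and> remaining_bids n \<rho> < remaining_bids n \<tau>) \<tau>"
      using state' \<open>u < n\<close> ptr cheapest \<open>p b \<le> n\<close> by (rule wp_bid)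
    then show ?thesis
      using False state' remaining
      by (auto simp: bid_or_fail_def auction_state_def elim: wp_mono simp del: wp_Seq)
  qed
qed

lemma wp_bid_step:
  assumes state: "auction_state n R u i p m \<sigma>" and "u < n"
  shows "wp_unit bid_step
    (\<lambda>t \<tau>. t \<le> 10 * n + 17 \<and> matching_inv n R \<tau> \<and> remaining_bids n \<tau> < remaining_bids n \<sigma>) \<sigma>"
proof -
  have "nmem \<sigma> size_reg = n"
    using state by (simp add: auction_state_def)
  then show ?thesis
    unfolding bid_step_def wp_Seq using wp_scan[of \<sigma>]
    by (auto elim!: wp_mono dest!: wp_bid_or_fail[OF assms])
qed

lemma price_slack_0: "price_slack n (\<lambda>_. 0) = n * Suc n"
  by (simp add: price_slack_def)

lemma matching_inv_finished:
  assumes "matching_inv n R \<sigma>" "\<not> nmem \<sigma> done_reg < nmem \<sigma> size_reg"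
  shows "nmem \<sigma> failed_reg = (if matchable (row_edge n R) {..<n} {..<n} then 0 else 1)"
  using assms(1) unfolding matching_inv_def
proof (elim disjE exE)
  fix u i p m assume state: "auction_state n R u i p m \<sigma>"
  then have "bidding n (row_edge n R) n i p m"
    using assms(2) by (auto simp: auction_state_def bidding_def)
  then show ?thesis
    using bidding_finished state by (auto simp: auction_state_def)
qed (simp add: failed_state_def)

definition matching_time :: "nat poly" where
  "matching_time = [:1, 1, 1:] * [:18, 10:] + [:2:]"

theorem wp_matching_prog:
  assumes "rmem \<sigma> = R" "nmem \<sigma> = (\<lambda>_. 0)(0 := n)"
  shows "wp_unit matching_prog
    (\<lambda>t \<tau>. t \<le> poly matching_time n \<and> answer \<tau> (matchable (row_edge n R) {..<n} {..<n})) \<sigma>"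
proof -
  let ?test = "NLess (NCell (Dir done_reg)) (NCell (Dir size_reg))"
  have "auction_state n R 0 0 (\<lambda>_. 0) Map.empty \<sigma>"
    using assms bidding_init by (simp add: auction_state_def)
  then have init: "matching_inv n R \<sigma>" "remaining_bids n \<sigma> = Suc (n * Suc n)"
    by (auto simp: matching_inv_def remaining_bids_auction_state price_slack_0)
  have step: "wp_unit bid_step
      (\<lambda>t \<tau>. t \<le> 10 * n + 17 \<and> matching_inv n R \<tau> \<and> remaining_bids n \<tau> < remaining_bids n \<sigma>) \<sigma>"
    if inv: "matching_inv n R \<sigma>" and test: "eval_test ?test \<sigma>" for \<sigma>
  proof -
    obtain u i p m where state: "auction_state n R u i p m \<sigma>"
      using inv test by (auto simp: matching_inv_def failed_state_def)
    then have "u < n" using test by (simp add: auction_state_def)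
    with state show ?thesis by (rule wp_bid_step)
  qed
  have "wp_unit (While ?test bid_step)
      (\<lambda>t \<tau>. t \<le> Suc (n * Suc n) * Suc (10 * n + 17) + 1 \<and>
        matching_inv n R \<tau> \<and> \<not> eval_test ?test \<tau>) \<sigma>"
    using wp_unit_While[where b = ?test and f = "remaining_bids n", OF step init(1)]
    unfolding init(2) by simp
  then show ?thesis
    unfolding matching_prog_def wp_Seq
    by (rule wp_mono)
      (auto simp: matching_time_def algebra_simps answer_def nat_store_def
        dest: matching_inv_finished)
qed

section \<open>Bit cost of programs that compute with natural numbers\<close>

fun prog_instrs :: "prog \<Rightarrow> instr set" where
  "prog_instrs Skip = {}"
| "prog_instrs (Do i) = {i}"
| "prog_instrs (Seq c d) = prog_instrs c \<union> prog_instrs d"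
| "prog_instrs (Cond _ c d) = prog_instrs c \<union> prog_instrs d"
| "prog_instrs (While _ c) = prog_instrs c"

fun prog_tests :: "prog \<Rightarrow> test set" where
  "prog_tests Skip = {}"
| "prog_tests (Do _) = {}"
| "prog_tests (Seq c d) = prog_tests c \<union> prog_tests d"
| "prog_tests (Cond b c d) = insert b (prog_tests c \<union> prog_tests d)"
| "prog_tests (While b c) = insert b (prog_tests c)"

lemma finite_prog_instrs: "finite (prog_instrs c)"
  by (induction c) simp_all

lemma finite_prog_tests: "finite (prog_tests c)"
  by (induction c) simp_all

lemma prog_instrs_block [simp]: "prog_instrs (block xs) = set xs"
  by (induction xs) simp_all

lemma exec_unit_imp_wp:
  assumes "exec_unit c \<sigma> t \<tau>" "P k \<sigma>" "k + t \<le> N" "prog_instrs c \<subseteq> Is" "prog_tests c \<subseteq> Ts"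
    and Suc: "\<And>k \<sigma>. P k \<sigma> \<Longrightarrow> P (Suc k) \<sigma>"
    and instr: "\<And>i k \<sigma>. i \<in> Is \<Longrightarrow> k < N \<Longrightarrow> P k \<sigma> \<Longrightarrow> ic i \<sigma> \<le> K \<and> P (Suc k) (exec_instr i \<sigma>)"
    and test: "\<And>b k \<sigma>. b \<in> Ts \<Longrightarrow> k < N \<Longrightarrow> P k \<sigma> \<Longrightarrow> tc b \<sigma> \<le> K"
    and "1 \<le> K"
  shows "P (k + t) \<tau> \<and> wp ic tc c (\<lambda>u \<rho>. \<rho> = \<tau> \<and> u \<le> t * K) \<sigma>"
  using assms(1-5)
proof (induction arbitrary: k rule: exec.induct)
  case (Skip \<sigma>)
  then show ?case using Suc \<open>1 \<le> K\<close> by simp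
next
  case (Do i \<sigma>)
  then show ?case using instr[of i k \<sigma>] by simp
next
  case (Seq c \<sigma> t \<sigma>' d u \<tau>)
  then show ?case
    using Seq.IH(1)[of k] Seq.IH(2)[of "k + t"]
    by (auto simp: add.assoc add_mult_distrib elim!: wp_mono)
next
  case (Cond_True b \<sigma> c t \<tau> d)
  then show ?case
    using Cond_True.IH[of "Suc k"] Suc test[of b k \<sigma>] by (auto elim!: wp_mono)
next
  case (Cond_False b \<sigma> d t \<tau> c)
  then show ?case
    using Cond_False.IH[of "Suc k"] Suc test[of b k \<sigma>] by (auto elim!: wp_mono)
next
  case (While_False b \<sigma> c)
  then show ?case
    using Suc test[of b k \<sigma>] by (simp add: wp_While_unfold[of _ _ b])
next
  case (While_True b \<sigma> c t \<sigma>' u \<tau>)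
  then show ?case
    using While_True.IH(1)[of "Suc k"] While_True.IH(2)[of "Suc k + t"] Suc test[of b k \<sigma>]
    by (subst wp_While_unfold) (auto simp: add.assoc add_mult_distrib elim!: wp_mono)
qed

lemma less_power_nat_bits: "v < 2 ^ nat_bits v"
  using floor_log_exp2_gt[of v] by (simp add: nat_bits_def)

lemma nat_bits_le:
  assumes "v < 2 ^ b"
  shows "nat_bits v \<le> Suc b"
proof (cases "v = 0")
  case False
  then have "(2 :: nat) ^ floor_log v < 2 ^ b"
    using le_less_trans[OF floor_log_exp2_le assms] by simp
  then show ?thesis by (simp add: nat_bits_def)
qed (simp add: nat_bits_def)

definition bounded_state :: "nat \<Rightarrow> nat \<Rightarrow> state \<Rightarrow> bool" where
  "bounded_state b r \<sigma> \<longleftrightarrow> (\<forall>x. nmem \<sigma> x < 2 ^ b) \<and> (\<forall>x. rat_bits (rmem \<sigma> x) \<le> r)"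

lemma bounded_state_mono: "bounded_state b r \<sigma> \<Longrightarrow> b \<le> b' \<Longrightarrow> bounded_state b' r \<sigma>"
  unfolding bounded_state_def by (meson less_le_trans one_le_numeral power_increasing)

text \<open>The bit cost of an instruction in this state measures the literals and addresses that it
  contains.\<close>

definition zero_state :: state where
  "zero_state = \<lparr>nmem = (\<lambda>_. 0), rmem = (\<lambda>_. 0)\<rparr>"

definition nat_instr :: "instr \<Rightarrow> bool" where
  "nat_instr i \<longleftrightarrow> (\<exists>l a b. i = NAdd l a b \<or> i = NSub l a b)"

context
  fixes b r :: nat and \<sigma> :: state
  assumes bounded: "bounded_state b r \<sigma>"
begin

lemma nat_bits_nmem_le: "nat_bits (nmem \<sigma> x) \<le> Suc b"
  using bounded by (simp add: bounded_state_def nat_bits_le)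

lemma rat_bits_rmem_le: "rat_bits (rmem \<sigma> x) \<le> r"
  using bounded by (simp add: bounded_state_def)

lemma addr_bits_le: "addr_bits l \<sigma> \<le> addr_bits l zero_state + b"
  using nat_bits_nmem_le by (cases l) (simp_all add: zero_state_def nat_bits_def)

lemma nat_operand_bits_le: "nat_operand_bits a \<sigma> \<le> nat_operand_bits a zero_state + 2 * b"
proof (cases a)
  case (NCell l)
  then show ?thesis
    using addr_bits_le[of l] nat_bits_nmem_le[of "addr l \<sigma>"]
    by (simp add: zero_state_def nat_bits_def)
qed simp

lemma real_operand_bits_le: "real_operand_bits a \<sigma> \<le> real_operand_bits a zero_state + b + r"
proof (cases a)
  case (RCell l)
  then show ?thesis
    using addr_bits_le[of l] rat_bits_rmem_le[of "addr l \<sigma>"] by simp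
qed simp

lemma test_bits_le: "test_bits t \<sigma> \<le> test_bits t zero_state + (4 * b + 2 * r)"
proof -
  have "nat_operand_bits x \<sigma> + nat_operand_bits y \<sigma>
      \<le> nat_operand_bits x zero_state + nat_operand_bits y zero_state + (4 * b + 2 * r)" for x y
    using nat_operand_bits_le[of x] nat_operand_bits_le[of y] by simp
  moreover have "real_operand_bits x \<sigma> + real_operand_bits y \<sigma>
      \<le> real_operand_bits x zero_state + real_operand_bits y zero_state + (4 * b + 2 * r)" for x y
    using real_operand_bits_le[of x] real_operand_bits_le[of y] by simp
  ultimately show ?thesis
    by (cases t) (simp_all only: test_bits.simps)
qed

lemma nat_instr_bits_le:
  assumes "nat_instr i"
  shows "instr_bits i \<sigma> \<le> instr_bits i zero_state + 5 * b"
proof -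
  obtain l x y where "i = NAdd l x y \<or> i = NSub l x y"
    using assms by (auto simp: nat_instr_def)
  then show ?thesis
    using addr_bits_le[of l] nat_operand_bits_le[of x] nat_operand_bits_le[of y] by auto
qed

lemma nat_val_less:
  assumes "nat_operand_bits a zero_state \<le> b"
  shows "nat_val a \<sigma> < 2 ^ b"
proof (cases a)
  case (NLit k)
  have "k < 2 ^ nat_bits k"
    by (rule less_power_nat_bits)
  also have "\<dots> \<le> 2 ^ b"
    using NLit assms by simp
  finally show ?thesis
    using NLit by simp
qed (use bounded in \<open>simp add: bounded_state_def\<close>)

lemma bounded_state_nat_instr:
  assumes "nat_instr i" "instr_bits i zero_state \<le> b"
  shows "bounded_state (Suc b) r (exec_instr i \<sigma>)"
proof -
  obtain l x y where instr: "i = NAdd l x y \<or> i = NSub l x y"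
    using assms(1) by (auto simp: nat_instr_def)
  then have "nat_val x \<sigma> < 2 ^ b" "nat_val y \<sigma> < 2 ^ b"
    using assms(2) by (auto intro!: nat_val_less)
  then have "nat_val x \<sigma> + nat_val y \<sigma> < 2 ^ Suc b"
    by simp
  moreover have "nmem \<sigma> z < 2 ^ Suc b" for z
    using bounded_state_mono[OF bounded, of "Suc b"] by (simp add: bounded_state_def)
  ultimately show ?thesis
    using instr bounded by (auto simp: bounded_state_def nat_store_def)
qed

end

text \<open>Each step lengthens the numbers by at most one bit.\<close>

lemma wp_bits_of_exec_unit:
  assumes "exec_unit c \<sigma> t \<tau>" "bounded_state b r \<sigma>"
    and instrs: "\<And>i. i \<in> prog_instrs c \<Longrightarrow> nat_instr i \<and> instr_bits i zero_state \<le> b"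
    and tests: "\<And>e. e \<in> prog_tests c \<Longrightarrow> test_bits e zero_state \<le> b"
  shows "wp instr_bits test_bits c (\<lambda>u \<rho>. \<rho> = \<tau> \<and> u \<le> t * Suc (6 * (b + t) + 2 * r)) \<sigma>"
proof -
  let ?P = "\<lambda>k. bounded_state (b + k) r" and ?K = "Suc (6 * (b + t) + 2 * r)"
  have "?P (0 + t) \<tau> \<and> wp instr_bits test_bits c (\<lambda>u \<rho>. \<rho> = \<tau> \<and> u \<le> t * ?K) \<sigma>"
    using assms(1)
  proof (rule exec_unit_imp_wp[where Is = "prog_instrs c" and Ts = "prog_tests c"])
    show "instr_bits i \<rho> \<le> ?K \<and> ?P (Suc k) (exec_instr i \<rho>)"
      if "i \<in> prog_instrs c" "k < t" "?P k \<rho>" for i k \<rho>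
      using nat_instr_bits_le[OF that(3), of i] bounded_state_nat_instr[OF that(3), of i]
        instrs[OF that(1)] that(2) by simp
    show "test_bits e \<rho> \<le> ?K" if "e \<in> prog_tests c" "k < t" "?P k \<rho>" for e k \<rho>
      using test_bits_le[OF that(3), of e] tests[OF that(1)] that(2) by simp
  qed (use assms(2) in \<open>auto intro: bounded_state_mono\<close>)
  then show ?thesis by blast
qed

lemma rat_bits_pos: "1 \<le> rat_bits x"
  by (auto simp: rat_bits_def nat_bits_def split: prod.split)

lemma rat_bits_le_mat_bits:
  assumes "i < dim_row M" "j < dim_col M"
  shows "rat_bits (M $$ (i, j)) \<le> mat_bits M"
proof -
  have "rat_bits (M $$ (i, j)) \<le> (\<Sum>j<dim_col M. rat_bits (M $$ (i, j)))"
    using assms by (intro member_le_sum) auto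
  also have "\<dots> \<le> mat_bits M"
    unfolding mat_bits_def using assms
    by (intro member_le_sum[where f = "\<lambda>i. \<Sum>j<dim_col M. rat_bits (M $$ (i, j))"]) auto
  finally show ?thesis .
qed

lemma dim_mult_le_mat_bits: "dim_row M * dim_col M \<le> mat_bits M"
proof -
  have "dim_row M * dim_col M = (\<Sum>i<dim_row M. \<Sum>j<dim_col M. 1)" by simp
  also have "\<dots> \<le> mat_bits M"
    unfolding mat_bits_def by (intro sum_mono rat_bits_pos)
  finally show ?thesis .
qed

lemma dim_row_le_mat_bits:
  assumes "square_mat M"
  shows "dim_row M \<le> mat_bits M"
proof -
  have "dim_row M \<le> dim_row M * dim_col M"
    using assms by (simp add: le_square)
  also have "\<dots> \<le> mat_bits M"
    by (rule dim_mult_le_mat_bits)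
  finally show ?thesis .
qed

lemma bounded_input_state:
  assumes "square_mat M"
  shows "bounded_state (dim_row M) (mat_bits M + rat_bits 0) (input_state M)"
proof -
  let ?n = "dim_row M"
  have "rat_bits (rmem (input_state M) x) \<le> mat_bits M + rat_bits 0" for x
  proof (cases "x < ?n * ?n")
    case True
    then have "0 < ?n" by (cases ?n) auto
    then have "x div ?n < ?n" "x mod ?n < dim_col M"
      using True assms by (simp_all add: less_mult_imp_div_less)
    then show ?thesis
      using rat_bits_le_mat_bits[of "x div ?n" M "x mod ?n"] True
      by (simp add: input_state_def Let_def)
  qed (simp add: input_state_def Let_def)
  then show ?thesis
    by (simp add: bounded_state_def input_state_def Let_def)
qed

lemma poly_nat_mono: "x \<le> y \<Longrightarrow> poly p x \<le> poly (p :: nat poly) y"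
  by (induction p) (auto intro: add_mono mult_mono)

lemma ex_static_bits_bound:
  "\<exists>s. (\<forall>i\<in>prog_instrs c. instr_bits i zero_state \<le> s) \<and>
    (\<forall>e\<in>prog_tests c. test_bits e zero_state \<le> s)"
proof -
  have "finite ((\<lambda>i. instr_bits i zero_state) ` prog_instrs c \<union>
      (\<lambda>e. test_bits e zero_state) ` prog_tests c)"
    by (simp add: finite_prog_instrs finite_prog_tests)
  then show ?thesis
    unfolding finite_nat_set_iff_bounded_le by blast
qed

definition bit_time :: "nat \<Rightarrow> nat poly \<Rightarrow> nat poly" where
  "bit_time s p = p * ([:1:] + [:6:] * ([:s, 1:] + p) + [:2:] * [:rat_bits 0, 1:])"

lemma exec_bits_input_state:
  assumes run: "exec_unit c (input_state M) t \<tau>" "t \<le> poly p (dim_row M)"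
    and square: "square_mat M"
    and instrs: "\<And>i. i \<in> prog_instrs c \<Longrightarrow> nat_instr i \<and> instr_bits i zero_state \<le> s"
    and tests: "\<And>e. e \<in> prog_tests c \<Longrightarrow> test_bits e zero_state \<le> s"
  shows "\<exists>u. exec_bits c (input_state M) u \<tau> \<and> u \<le> poly (bit_time s p) (mat_bits M)"
proof -
  let ?n = "dim_row M" and ?m = "mat_bits M"
  have "bounded_state (s + ?n) (?m + rat_bits 0) (input_state M)"
    by (rule bounded_state_mono[OF bounded_input_state[OF square]]) simp
  then have "wp instr_bits test_bits c
      (\<lambda>u \<rho>. \<rho> = \<tau> \<and> u \<le> t * Suc (6 * (s + ?n + t) + 2 * (?m + rat_bits 0))) (input_state M)"
    using run(1) instrs tests by (intro wp_bits_of_exec_unit) (auto intro: trans_le_add1)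
  then obtain u where "exec_bits c (input_state M) u \<tau>"
    and cost: "u \<le> t * Suc (6 * (s + ?n + t) + 2 * (?m + rat_bits 0))"
    by (auto simp: wp_def)
  have "?n \<le> ?m"
    using square by (rule dim_row_le_mat_bits)
  moreover from this have "t \<le> poly p ?m"
    using run(2) poly_nat_mono order_trans by blast
  ultimately have "t * Suc (6 * (s + ?n + t) + 2 * (?m + rat_bits 0))
      \<le> poly p ?m * Suc (6 * (s + ?m + poly p ?m) + 2 * (?m + rat_bits 0))"
    by (intro mult_le_mono) auto
  also have "\<dots> = poly (bit_time s p) ?m"
    by (simp add: bit_time_def)
  finally show ?thesis
    using \<open>exec_bits c (input_state M) u \<tau>\<close> cost by (blast intro: order_trans)
qed

theorem poly_time_decides_nat_prog:
  assumes nat: "\<And>i. i \<in> prog_instrs c \<Longrightarrow> nat_instr i"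
    and square: "\<And>M. M \<in> I \<Longrightarrow> square_mat M"
    and unit: "\<And>M. M \<in> I \<Longrightarrow>
      wp_unit c (\<lambda>t \<tau>. t \<le> poly p (dim_row M) \<and> answer \<tau> (P M)) (input_state M)"
  shows "poly_time_decides c I P"
proof -
  obtain s where static: "\<And>i. i \<in> prog_instrs c \<Longrightarrow> instr_bits i zero_state \<le> s"
    "\<And>e. e \<in> prog_tests c \<Longrightarrow> test_bits e zero_state \<le> s"
    using ex_static_bits_bound[of c] by blast
  have run: "\<exists>t \<tau>. exec_unit c (input_state M) t \<tau> \<and> t \<le> poly p (dim_row M) \<and> answer \<tau> (P M)"
    if "M \<in> I" for M
    using unit[OF that] by (simp add: wp_def)
  moreover have "\<exists>t \<tau>. exec_bits c (input_state M) t \<tau> \<and> t \<le> poly (bit_time s p) (mat_bits M) \<and>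
      answer \<tau> (P M)" if "M \<in> I" for M
    using run[OF that] exec_bits_input_state square[OF that] nat static by meson
  ultimately show ?thesis
    unfolding poly_time_decides_def by blast
qed

section \<open>Deciding the existence of an invertible signing\<close>

lemma row_edge_input_state:
  assumes "i < dim_row M" "j < dim_row M"
  shows "row_edge (dim_row M) (rmem (input_state M)) i j \<longleftrightarrow> M $$ (i, j) \<noteq> 0"
proof -
  have "i * dim_row M + j < Suc i * dim_row M"
    using assms(2) by simp
  also have "\<dots> \<le> dim_row M * dim_row M"
    using assms(1) by (intro mult_le_mono1) simp
  finally show ?thesis
    using assms(2) by (simp add: row_edge_def input_state_def Let_def)
qed

lemma matchable_input_state_iff:
  assumes "symmetric_mat M" "dim_row M = n"
  shows "matchable (row_edge n (rmem (input_state M))) {..<n} {..<n} \<longleftrightarrow> invertible_signing M"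
proof -
  have "row_edge n (rmem (input_state M)) i (q i) \<longleftrightarrow> M $$ (i, q i) \<noteq> 0"
    if "q permutes {..<n}" "i < n" for q i
    using permutes_in_image[OF that(1), of i] that(2) row_edge_input_state[of i M "q i"] assms(2)
    by simp
  then show ?thesis
    unfolding invertible_signing_iff_permutation[OF assms]
      matchable_self_iff_permutes[OF finite_lessThan] by auto
qed

lemma nat_instr_matching_prog: "i \<in> prog_instrs matching_prog \<Longrightarrow> nat_instr i"
  by (auto simp: matching_prog_def bid_step_def bid_or_fail_def scan_def scan_step_def
      report_failure_def place_bid_def select_bidder_def nat_instr_def)

theorem theorem3:
  shows "\<exists>c. poly_time_decides c {M :: real mat. symmetric_mat M} invertible_signing"
proof (intro exI poly_time_decides_nat_prog)
  show "nat_instr i" if "i \<in> prog_instrs matching_prog" for i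
    using that by (rule nat_instr_matching_prog)
next
  fix M :: "real mat" assume "M \<in> {M. symmetric_mat M}"
  then have sym: "symmetric_mat M" by simp
  then show "square_mat M" by (simp add: symmetric_mat_def)
  have "nmem (input_state M) = (\<lambda>_. 0)(0 := dim_row M)"
    by (simp add: input_state_def Let_def)
  from wp_matching_prog[OF refl this] show "wp_unit matching_prog
      (\<lambda>t \<tau>. t \<le> poly matching_time (dim_row M) \<and> answer \<tau> (invertible_signing M)) (input_state M)"
    by (simp only: matchable_input_state_iff[OF sym refl])
qed

end
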